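(* Let $\{n_k\}_{k\ge 1}$ be integers with $n_k\ge 2$, let $\{r_k\}_{k\ge 1}$ be positive reals, and let $E,F\in\mathscr F([0,1],\{n_k\}_{k\ge 1},\{r_k\}_{k\ge 1})$ be two homogeneous Moran sets, with uniform Bernoulli measures $\mu$ on $E$ and $\nu$ on $F$. Let $f:E\to F$ be a bi-Lipschitz map (onto $F$). Suppose that (i) $\sup_{k\ge 1} n_k<\infty$; (ii) $\gamma=\inf_{k\ge 1}\frac{\Delta_k}{\Delta_{k+1}}>1$, where $\Delta_k$ is the total gap of rank $k$; (iii) both $E$ and $F$ satisfy the weak separation condition. Then for any cylinder $E_{\boldsymbol\sigma}$ of $E$ there exists a sub-cylinder $E_{\boldsymbol{\sigma\tau}}$ of $E_{\boldsymbol\sigma}$ such that the Radon–Nikodym derivative $df^*\nu/d\mu$ is a constant function on $E_{\boldsymbol{\sigma\tau}}$ ($\mu$-almost everywhere), where $f^*\nu(\cdot)=\nu(f(\cdot))$; equivalently, $$\frac{\nu(f(\mathbf B))}{\mu(\mathbf B)}=\frac{\nu(f(E_{\boldsymbol{\sigma\tau}}))}{\mu(E_{\boldsymbol{\sigma\tau}})}$$ for any Borel set $\mathbf B\subset E_{\boldsymbol{\sigma\tau}}$ with $\mu(\mathbf B)>0$.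
   Context: Words: let $\Sigma^0$ consist of the empty word $\emptyset$, $\Sigma^k=\prod_{j=1}^k\{0,\dots,n_j-1\}$ for $k\ge1$, and $\Sigma^*=\bigcup_{k\ge0}\Sigma^k$. Concatenation of words is written $\boldsymbol\sigma*\boldsymbol\tau$ or $\boldsymbol{\sigma\tau}$. $|A|$ denotes the diameter of a set $A\subset\mathbb R$, and $\mathrm{dist}(A,B)=\inf\{|x-y|: x\in A,y\in B\}$. Moran sets: let $J$ be a closed interval. A collection $\{J_{\boldsymbol\sigma}:\boldsymbol\sigma\in\Sigma^*\}$ of closed subintervals of $J$ has a Moran structure if $J_\emptyset=J$ and, for every $k\ge1$ and $\boldsymbol\sigma\in\Sigma^{k-1}$, the intervals $J_{\boldsymbol\sigma*i}$, $i\in\{0,\dots,n_k-1\}$, are subintervals of $J_{\boldsymbol\sigma}$ with pairwise disjoint interiors. The associated Moran set is $F=\bigcap_{k\ge0}\bigcup_{\boldsymbol\sigma\in\Sigma^k}J_{\boldsymbol\sigma}$. It is homogeneous with parameters $(J,\{n_k\},\{r_k\})$ if moreover $|J_{\boldsymbol\sigma*i}|/|J_{\boldsymbol\sigma}|=r_k$ for all $k\ge1$, $\boldsymbol\sigma\in\Sigma^{k-1}$, $0\le i\le n_k-1$. The class of such sets (each with its Moran structure) is $\mathscr F(J,\{n_k\},\{r_k\})$. Two members of the class may have different placements of the intervals. For $\boldsymbol\sigma\in\Sigma^k$, $J_{\boldsymbol\sigma}$ is a basic interval of rank $k$ and $F_{\boldsymbol\sigma}=J_{\boldsymbol\sigma}\cap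 F$ is a cylinder of rank $k$. For a Moran set $E$, cylinders are denoted $E_{\boldsymbol\sigma}$ similarly; a sub-cylinder of $E_{\boldsymbol\sigma}$ is a cylinder $E_{\boldsymbol{\sigma\tau}}$ with $\boldsymbol{\sigma\tau}\in\Sigma^*$. Total gaps: for $J=[0,1]$, $\Delta_1=1-n_1r_1$ and $\Delta_k=r_1\cdots r_{k-1}(1-n_kr_k)$ for $k\ge2$. The quotients $\Delta_k/\Delta_{k+1}$ are understood with all $\Delta_k>0$. Weak separation condition (WSC): a Moran set with basic intervals $J_{\boldsymbol\sigma}$ satisfies the WSC if there is a constant $\eta_0>0$ such that for all $k\ge0$, $\boldsymbol\sigma\in\Sigma^k$ and $i\ne j$ in $\{0,\dots,n_{k+1}-1\}$, either $J_{\boldsymbol\sigma*i}\cap J_{\boldsymbol\sigma*j}\ne\emptyset$ or $\mathrm{dist}(J_{\boldsymbol\sigma*i},J_{\boldsymbol\sigma*j})>\eta_0\left(|J_{\boldsymbol\sigma}|-\sum_{i=0}^{n_{k+1}-1}|J_{\boldsymbol\sigma*i}|\right)$. Uniform Bernoulli measure of $E$: the Borel probability measure $\mu$ supported on $E$ with $\mu(E_{\boldsymbol\sigma})=\frac1{n_1\cdots n_k}$ for each cylinder $E_{\boldsymbol\sigma}$ of rank $k$; $\nu$ is defined in the same way for $F$. A map $f:E\to F$ is bi-Lipschitz if it is onto and there is $C>0$ with $C^{-1}|x-y|\le|f(x)-f(y)|\le C|x-y|$ for all $x,y\in E$. *)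

theory Defs
  imports "HOL-Probability.Probability"
begin

text \<open>
  Sequences \<open>n\<close>, \<open>r\<close> are indexed from \<open>1\<close>; their values at \<open>0\<close> are never used.
  A word is a list, whose \<open>j\<close>-th letter (counted from \<open>1\<close>) is \<open>\<sigma> ! (j - 1)\<close>.
\<close>

definition words :: "(nat \<Rightarrow> nat) \<Rightarrow> nat \<Rightarrow> nat list set" where
  "words n k = {\<sigma>. length \<sigma> = k \<and> (\<forall>j\<in>{1..k}. \<sigma> ! (j - 1) < n j)}"

definition all_words :: "(nat \<Rightarrow> nat) \<Rightarrow> nat list set" where
  "all_words n = (\<Union>k. words n k)"

definition closed_interval :: "real set \<Rightarrow> bool" where
  "closed_interval I \<longleftrightarrow> (\<exists>a b. a \<le> b \<and> I = {a..b})"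

text \<open>
  A collection of basic intervals is a function on lists, of which only the values on
  \<open>all_words n\<close> matter.
\<close>

definition moran_structure ::
    "real set \<Rightarrow> (nat \<Rightarrow> nat) \<Rightarrow> (nat list \<Rightarrow> real set) \<Rightarrow> bool" where
  "moran_structure I n J \<longleftrightarrow>
     closed_interval I \<and>
     (\<forall>\<sigma>\<in>all_words n. closed_interval (J \<sigma>) \<and> J \<sigma> \<subseteq> I) \<and>
     J [] = I \<and>
     (\<forall>k\<ge>1. \<forall>\<sigma>\<in>words n (k - 1).
        (\<forall>i<n k. J (\<sigma> @ [i]) \<subseteq> J \<sigma>) \<and>
        (\<forall>i<n k. \<forall>j<n k. i \<noteq> j \<longrightarrow>
           interior (J (\<sigma> @ [i])) \<inter> interior (J (\<sigma> @ [j])) = {}))"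

definition moran_set :: "(nat \<Rightarrow> nat) \<Rightarrow> (nat list \<Rightarrow> real set) \<Rightarrow> real set" where
  "moran_set n J = (\<Inter>k. \<Union>\<sigma>\<in>words n k. J \<sigma>)"

definition homogeneous_moran_structure ::
    "real set \<Rightarrow> (nat \<Rightarrow> nat) \<Rightarrow> (nat \<Rightarrow> real) \<Rightarrow> (nat list \<Rightarrow> real set) \<Rightarrow> bool" where
  "homogeneous_moran_structure I n r J \<longleftrightarrow>
     moran_structure I n J \<and>
     (\<forall>k\<ge>1. \<forall>\<sigma>\<in>words n (k - 1). \<forall>i<n k.
        diameter (J (\<sigma> @ [i])) / diameter (J \<sigma>) = r k)"

definition cylinder :: "(nat \<Rightarrow> nat) \<Rightarrow> (nat list \<Rightarrow> real set) \<Rightarrow> nat list \<Rightarrow> real set" where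
  "cylinder n J \<sigma> = J \<sigma> \<inter> moran_set n J"

text \<open>For \<open>k = 1\<close> the product is empty.\<close>

definition total_gap :: "(nat \<Rightarrow> nat) \<Rightarrow> (nat \<Rightarrow> real) \<Rightarrow> nat \<Rightarrow> real" where
  "total_gap n r k = (\<Prod>j=1..k - 1. r j) * (1 - real (n k) * r k)"

definition weak_separation :: "(nat \<Rightarrow> nat) \<Rightarrow> (nat list \<Rightarrow> real set) \<Rightarrow> bool" where
  "weak_separation n J \<longleftrightarrow>
     (\<exists>\<eta>>0. \<forall>k. \<forall>\<sigma>\<in>words n k. \<forall>i<n (k + 1). \<forall>j<n (k + 1). i \<noteq> j \<longrightarrow>
        J (\<sigma> @ [i]) \<inter> J (\<sigma> @ [j]) \<noteq> {} \<or>
        setdist (J (\<sigma> @ [i])) (J (\<sigma> @ [j]))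
          > \<eta> * (diameter (J \<sigma>) - (\<Sum>l<n (k + 1). diameter (J (\<sigma> @ [l])))))"

definition uniform_bernoulli ::
    "(nat \<Rightarrow> nat) \<Rightarrow> (nat list \<Rightarrow> real set) \<Rightarrow> real measure \<Rightarrow> bool" where
  "uniform_bernoulli n J \<mu> \<longleftrightarrow>
     prob_space \<mu> \<and> sets \<mu> = sets borel \<and>
     measure \<mu> (moran_set n J) = 1 \<and>
     (\<forall>k. \<forall>\<sigma>\<in>words n k. measure \<mu> (cylinder n J \<sigma>) = 1 / real (\<Prod>j=1..k. n j))"

definition bi_lipschitz_onto :: "real set \<Rightarrow> real set \<Rightarrow> (real \<Rightarrow> real) \<Rightarrow> bool" where
  "bi_lipschitz_onto E F f \<longleftrightarrow>
     f ` E = F \<and>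
     (\<exists>C>0. \<forall>x\<in>E. \<forall>y\<in>E.
        inverse C * \<bar>x - y\<bar> \<le> \<bar>f x - f y\<bar> \<and> \<bar>f x - f y\<bar> \<le> C * \<bar>x - y\<bar>)"

text \<open>
  The measure \<open>B \<mapsto> \<nu> (f ` B)\<close> on the Borel subsets of \<open>E\<close>.  The constant \<open>measure_of\<close>
  returns the zero measure unless this set function is a measure; it is one whenever \<open>E\<close>
  is compact, \<open>\<nu>\<close> is Borel and \<open>f\<close> is a homeomorphism of \<open>E\<close> onto its image.
\<close>

definition pullback_measure :: "real set \<Rightarrow> (real \<Rightarrow> real) \<Rightarrow> real measure \<Rightarrow> real measure" where
  "pullback_measure E f \<nu> =
     measure_of E (sets (restrict_space borel E)) (\<lambda>B. emeasure \<nu> (f ` B))"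

end

theory Submission
  imports Defs
begin

text \<open>
  Write \<open>\<rho> B = \<nu> (f ` B)\<close> for Borel subsets \<open>B\<close> of \<open>E\<close>. The proof finds pieces of \<open>E\<close> on which
  the ratio \<open>\<rho> / \<mu>\<close> can take only a discrete set of values, chooses a piece where this ratio is
  minimal, and concludes that \<open>\<rho>\<close> is a multiple of \<open>\<mu>\<close> there: no smaller piece has a smaller ratio,
  while the ratio of the whole piece is an average of the ratios of the smaller ones.

  Cylinders are unsuitable as pieces, because neighbouring basic intervals may touch. The pieces used
  are clusters: two points of \<open>E\<close> belong to the same \<open>\<delta>\<close>-cluster if no gap of \<open>E\<close> longer than
  \<open>\<delta>\<close> separates them. Clusters partition \<open>E\<close>, become finer as \<open>\<delta>\<close> decreases, and lie at
  distance at least \<open>\<delta>\<close> from the rest of \<open>E\<close>. At rank \<open>k\<close> the threshold is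
  \<open>\<delta> = \<Delta>\<^bsub>k+1\<^esub> / (8 N)\<close>, where \<open>N\<close> bounds all \<open>n\<^sub>j\<close>. Two facts make this scale the
  right one.

  First, every basic interval of rank \<open>k\<close> contains a gap longer than \<open>\<delta>\<close>, since its children
  leave a length \<open>\<Delta>\<^bsub>k+1\<^esub>\<close> uncovered (\<open>long_gap_exists\<close>). Hence a cluster cannot extend
  over a whole basic interval of rank \<open>k\<close>; it meets at most two of them
  (\<open>prob_part_le\<close>) and its diameter is at most three times their length (\<open>part_diameter\<close>).

  Second, since the total gaps decay geometrically, all gaps of \<open>E\<close> inside a basic interval of rank
  \<open>m\<close> are at most a constant times \<open>\<Delta>\<^bsub>m+1\<^esub>\<close> (\<open>gaps_small\<close>). So with a constant \<open>l\<close>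
  that does not depend on \<open>k\<close>, a cylinder of rank \<open>k + l\<close> cannot be split by a subset that is
  \<open>\<delta>\<close>-isolated (\<open>isolated_part_eq_Union\<close>). The same applies to \<open>F\<close> and the image of a cluster,
  which is \<open>\<delta> / C\<close>-isolated because \<open>f\<close> is bi-Lipschitz.

  Consequently a cluster is a union of \<open>a\<close> cylinders of rank \<open>k + l\<close> of \<open>E\<close> and its image is a union of
  \<open>b\<close> cylinders of the same rank of \<open>F\<close>, so that its ratio is \<open>b / a\<close>. Here \<open>a \<le> 2 N ^ l\<close> by the
  first fact, so all these ratios are integer multiples of a fixed positive number
  (\<open>part_ratio_discrete\<close>), and among the clusters inside a given open set one has minimal ratio. The
  inequality between the two measures passes from clusters to all Borel sets by outer regularity
  (\<open>emeasure_le_of_partitions\<close>).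

  Absolute continuity comes from the same comparison: the image of a cylinder of rank \<open>k\<close> lies in an
  interval of length \<open>2 C\<close> times that of a basic interval of rank \<open>k\<close>, so it meets at most
  \<open>2 C + 2\<close> cylinders of \<open>F\<close> of rank \<open>k\<close> (\<open>\<rho>_cylinder_le\<close>), and \<open>\<rho> \<le> (2 C + 2) \<mu>\<close> follows.
\<close>

section \<open>Clusters of a set of reals\<close>

text \<open>
  Points of \<open>E\<close> lie in the same cluster iff every gap \<open>{u<..<v}\<close> of \<open>E\<close> longer than \<open>\<delta>\<close> has
  them on the same side. Comparing both points with \<open>u\<close> alone decides this, because no point of
  \<open>E\<close> lies inside the gap; this form makes it evident that clusters are equivalence classes.
\<close>
definition cluster :: "real set \<Rightarrow> real \<Rightarrow> real \<Rightarrow> real set" where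
  "cluster E \<delta> x =
     {y \<in> E. \<forall>u v. u + \<delta> < v \<and> {u<..<v} \<inter> E = {} \<longrightarrow> (x \<le> u \<longleftrightarrow> y \<le> u)}"

lemma cluster_subset: "cluster E \<delta> x \<subseteq> E"
  by (auto simp: cluster_def)

lemma self_in_cluster: "x \<in> E \<Longrightarrow> x \<in> cluster E \<delta> x"
  by (auto simp: cluster_def)

lemma cluster_eq: "y \<in> cluster E \<delta> x \<Longrightarrow> cluster E \<delta> y = cluster E \<delta> x"
  by (auto simp: cluster_def)

lemma cluster_mono: "\<delta> \<le> \<delta>' \<Longrightarrow> cluster E \<delta> x \<subseteq> cluster E \<delta>' x"
  unfolding cluster_def by (smt (verit) Collect_mono)

lemma cluster_isolated:
  assumes "y \<in> cluster E \<delta> x" "z \<in> E" "z \<notin> cluster E \<delta> x"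
  shows "\<delta> < \<bar>y - z\<bar>"
proof -
  have "z \<notin> cluster E \<delta> y"
    using assms cluster_eq by metis
  then obtain u v where uv: "u + \<delta> < v" "{u<..<v} \<inter> E = {}" "\<not> (y \<le> u \<longleftrightarrow> z \<le> u)"
    using assms(2) by (auto simp: cluster_def)
  have "y \<in> E" using assms(1) by (auto simp: cluster_def)
  then have "y \<le> u \<or> v \<le> y" "z \<le> u \<or> v \<le> z"
    using uv(2) assms(2) by force+
  with uv show ?thesis by linarith
qed

text \<open>
  Let \<open>s\<close> be the supremum of the points of \<open>B\<close> between \<open>x\<close> and \<open>y\<close>. Points of \<open>B\<close> close to \<open>s\<close>
  keep the points of \<open>E - B\<close> away, and no point of \<open>B\<close> below \<open>y\<close> exceeds \<open>s\<close>, so a gap starts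
  at \<open>s\<close>. The distance \<open>2 * \<delta>\<close> leaves room for the case that \<open>s\<close> is not attained.
\<close>
lemma gap_above_isolated_part:
  fixes B E :: "real set"
  assumes iso: "\<And>b z. b \<in> B \<Longrightarrow> z \<in> E - B \<Longrightarrow> 2 * \<delta> \<le> \<bar>b - z\<bar>"
    and "0 < \<delta>" "x \<in> B" "y \<in> E - B" "x < y"
  shows "\<exists>u v. u + \<delta> < v \<and> {u<..<v} \<inter> E = {} \<and> x \<le> u \<and> v \<le> y"
proof -
  define S where "S = {b \<in> B. x \<le> b \<and> b \<le> y}"
  have "x \<in> S" and bdd: "bdd_above S"
    using assms by (auto simp: S_def intro: bdd_aboveI[of _ y])
  define s where "s = Sup S"
  have "x \<le> s" unfolding s_def using \<open>x \<in> S\<close> bdd by (rule cSup_upper)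
  obtain b where b: "b \<in> S" "s - \<delta> / 2 < b"
    using less_cSup_iff[of S "s - \<delta> / 2"] \<open>x \<in> S\<close> bdd \<open>0 < \<delta>\<close> by (force simp: s_def)
  have "b \<le> s" unfolding s_def using b(1) bdd by (rule cSup_upper)
  have "b + 2 * \<delta> \<le> y"
    using iso[of b y] b(1) assms(4) by (simp add: S_def)
  have "z \<notin> {s<..<b + 2 * \<delta>}" if "z \<in> E" for z
  proof (cases "z \<in> B")
    case True
    show ?thesis
    proof
      assume z: "z \<in> {s<..<b + 2 * \<delta>}"
      then have "z \<in> S" using True \<open>x \<le> s\<close> \<open>b + 2 * \<delta> \<le> y\<close> by (auto simp: S_def)
      then have "z \<le> s" unfolding s_def using bdd by (rule cSup_upper)
      with z show False by simp
    qed
  next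
    case False
    then have "2 * \<delta> \<le> \<bar>b - z\<bar>" using iso[of b z] that b(1) by (auto simp: S_def)
    with \<open>b \<le> s\<close> show ?thesis by auto
  qed
  then have "{s<..<b + 2 * \<delta>} \<inter> E = {}" by blast
  moreover have "s + \<delta> < b + 2 * \<delta>" using b(2) \<open>0 < \<delta>\<close> by simp
  ultimately show ?thesis using \<open>x \<le> s\<close> \<open>b + 2 * \<delta> \<le> y\<close> by blast
qed

lemma cluster_subset_isolated:
  fixes B E :: "real set"
  assumes "B \<subseteq> E" and iso: "\<And>b z. b \<in> B \<Longrightarrow> z \<in> E - B \<Longrightarrow> 2 * \<delta> \<le> \<bar>b - z\<bar>"
    and "0 < \<delta>" "x \<in> B"
  shows "cluster E \<delta> x \<subseteq> B"
proof
  fix y assume y: "y \<in> cluster E \<delta> x"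
  show "y \<in> B"
  proof (rule ccontr)
    assume "y \<notin> B"
    with y have yE: "y \<in> E - B" by (auto simp: cluster_def)
    have "\<exists>u v. u + \<delta> < v \<and> {u<..<v} \<inter> E = {} \<and> (x \<le> u \<and> v \<le> y \<or> y \<le> u \<and> v \<le> x)"
    proof (cases "x < y")
      case True
      then show ?thesis using gap_above_isolated_part[of B E \<delta> x y] iso assms yE by blast
    next
      case False
      then have "y < x" using yE \<open>x \<in> B\<close> by (cases "x = y") auto
      \<comment> \<open>The complement \<open>E - B\<close> is isolated as well and contains the lower point \<open>y\<close>.\<close>
      moreover have "2 * \<delta> \<le> \<bar>b - z\<bar>" if "b \<in> E - B" "z \<in> E - (E - B)" for b z
        using iso[of z b] that by (simp add: abs_minus_commute)
      ultimately show ?thesis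
        using gap_above_isolated_part[of "E - B" E \<delta> y x] assms yE by blast
    qed
    then show False using y \<open>0 < \<delta>\<close> unfolding cluster_def by (smt (verit) mem_Collect_eq)
  qed
qed

section \<open>Intervals and Lebesgue measure\<close>

text \<open>Only the open intervals need to be disjoint, so basic intervals that share an endpoint are admitted.\<close>
lemma interval_packing:
  fixes c d :: "'i \<Rightarrow> real"
  assumes "finite S" "\<And>i. i \<in> S \<Longrightarrow> c i \<le> d i" "\<And>i. i \<in> S \<Longrightarrow> {c i<..<d i} \<subseteq> X"
    and "disjoint_family_on (\<lambda>i. {c i<..<d i}) S" and "X \<in> fmeasurable lborel"
  shows "(\<Sum>i\<in>S. d i - c i) \<le> measure lborel X"
proof -
  have "(\<Sum>i\<in>S. d i - c i) = (\<Sum>i\<in>S. measure lborel {c i<..<d i})"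
    using assms(2) by simp
  also have "\<dots> = measure lborel (\<Union>i\<in>S. {c i<..<d i})"
    using assms(1,2,4) by (intro measure_finite_Union[symmetric]) auto
  also have "\<dots> \<le> measure lborel X"
    using assms by (intro measure_mono_fmeasurable) auto
  finally show ?thesis .
qed

lemma interval_covering:
  fixes c d :: "'i \<Rightarrow> real"
  assumes "finite S" "\<And>i. i \<in> S \<Longrightarrow> c i \<le> d i" "{a<..<b} \<subseteq> (\<Union>i\<in>S. {c i..d i})" "a \<le> b"
  shows "b - a \<le> (\<Sum>i\<in>S. d i - c i)"
proof -
  have "b - a = measure lborel {a<..<b}" using assms(4) by simp
  also have "\<dots> \<le> measure lborel (\<Union>i\<in>S. {c i..d i})"
    using assms by (intro measure_mono_fmeasurable fmeasurable.finite_UN) (auto intro!: fmeasurableI)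
  also have "\<dots> \<le> (\<Sum>i\<in>S. measure lborel {c i..d i})"
    using assms by (intro measure_UNION_le) auto
  also have "\<dots> = (\<Sum>i\<in>S. d i - c i)" using assms(2) by simp
  finally show ?thesis .
qed

section \<open>Comparison of measures\<close>

text \<open>
  An inequality between two measures on the cells of a refining sequence of finite partitions with
  shrinking cells extends to all Borel sets. For an open set \<open>U\<close>, the cells of level \<open>k\<close> that lie in
  \<open>U\<close> form a finite disjoint family, and their unions increase to \<open>U \<inter> A\<close>; outer regularity then
  handles arbitrary Borel sets.
\<close>
lemma emeasure_le_of_partitions:
  fixes \<alpha> \<beta> :: "real measure" and Q :: "nat \<Rightarrow> real \<Rightarrow> real set"
  assumes sets: "sets \<alpha> = sets borel" "sets \<beta> = sets borel"
    and fin: "finite_measure \<alpha>" "finite_measure \<beta>"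
    and A: "A \<in> sets borel"
    and self: "\<And>k x. x \<in> A \<Longrightarrow> x \<in> Q k x"
    and eq: "\<And>k x y. x \<in> A \<Longrightarrow> y \<in> Q k x \<Longrightarrow> Q k y = Q k x"
    and nested: "\<And>k x. x \<in> A \<Longrightarrow> Q (Suc k) x \<subseteq> Q k x"
    and sub: "\<And>k x. x \<in> A \<Longrightarrow> Q k x \<subseteq> A"
    and finite: "\<And>k. finite (Q k ` A)"
    and meas: "\<And>k x. x \<in> A \<Longrightarrow> Q k x \<in> sets borel"
    and shrink: "\<And>x U. x \<in> A \<Longrightarrow> open U \<Longrightarrow> x \<in> U \<Longrightarrow> \<exists>k. Q k x \<subseteq> U"
    and le: "\<And>k x. x \<in> A \<Longrightarrow> emeasure \<alpha> (Q k x) \<le> emeasure \<beta> (Q k x)"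
    and B: "B \<in> sets borel" "B \<subseteq> A"
  shows "emeasure \<alpha> B \<le> emeasure \<beta> B"
proof -
  have open_le: "emeasure \<alpha> B \<le> emeasure \<beta> U" if U: "open U" "B \<subseteq> U" for U
  proof -
    define V where "V k = {x \<in> A. Q k x \<subseteq> U}" for k
    have V_Union: "V k = \<Union>(Q k ` V k)" for k
    proof
      show "V k \<subseteq> \<Union>(Q k ` V k)" using self by (auto simp: V_def)
      show "\<Union>(Q k ` V k) \<subseteq> V k"
      proof
        fix z assume "z \<in> \<Union>(Q k ` V k)"
        then obtain x where x: "x \<in> A" "Q k x \<subseteq> U" "z \<in> Q k x" by (auto simp: V_def)
        then have "z \<in> A" "Q k z = Q k x" using sub eq by blast+
        with x show "z \<in> V k" by (simp add: V_def)
      qed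
    qed
    have fin_V: "finite (Q k ` V k)" for k
      using finite[of k] by (rule finite_subset[rotated]) (auto simp: V_def)
    have Q_borel: "Q k ` V k \<subseteq> sets borel" for k
      using meas by (auto simp: V_def)
    have V_borel: "V k \<in> sets borel" for k
      using fin_V Q_borel by (subst V_Union) (rule sets.finite_Union)
    have disj: "disjoint_family_on (\<lambda>S. S) (Q k ` V k)" for k
      unfolding disjoint_family_on_def
    proof (intro ballI impI)
      fix S T assume "S \<in> Q k ` V k" "T \<in> Q k ` V k" "S \<noteq> T"
      then obtain x y where xy: "x \<in> A" "y \<in> A" "S = Q k x" "T = Q k y" by (auto simp: V_def)
      show "S \<inter> T = {}"
      proof (rule ccontr)
        assume "S \<inter> T \<noteq> {}"
        then obtain z where "z \<in> Q k x" "z \<in> Q k y" using xy by auto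
        then have "Q k x = Q k y" using eq xy(1,2) by metis
        with xy \<open>S \<noteq> T\<close> show False by simp
      qed
    qed
    have V_le: "emeasure \<alpha> (V k) \<le> emeasure \<beta> U" for k
    proof -
      have sum: "emeasure M (V k) = (\<Sum>S\<in>Q k ` V k. emeasure M S)" if "sets M = sets borel" for M
        using sum_emeasure[of "\<lambda>S. S" "Q k ` V k" M] that Q_borel disj fin_V V_Union[of k] by simp
      have "emeasure \<alpha> (V k) \<le> emeasure \<beta> (V k)"
        unfolding sum[OF sets(1)] sum[OF sets(2)]
        by (rule sum_mono) (use le in \<open>auto simp: V_def\<close>)
      also have "\<dots> \<le> emeasure \<beta> U"
        using self U sets by (intro emeasure_mono) (auto simp: V_def)
      finally show ?thesis .
    qed
    have "incseq V"
      using nested by (intro incseq_SucI) (auto simp: V_def)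
    have "B \<subseteq> (\<Union>k. V k)"
    proof
      fix x assume "x \<in> B"
      then obtain k where "Q k x \<subseteq> U" using shrink[of x U] B U by blast
      then show "x \<in> (\<Union>k. V k)" using \<open>x \<in> B\<close> B by (auto simp: V_def)
    qed
    then have "emeasure \<alpha> B \<le> emeasure \<alpha> (\<Union>k. V k)"
      using V_borel sets by (intro emeasure_mono) auto
    also have "\<dots> = (SUP k. emeasure \<alpha> (V k))"
      using \<open>incseq V\<close> V_borel sets by (intro SUP_emeasure_incseq[symmetric]) auto
    also have "\<dots> \<le> emeasure \<beta> U"
      using V_le by (intro SUP_least)
    finally show ?thesis .
  qed
  have "emeasure \<beta> (space \<beta>) \<noteq> \<infinity>"
    using fin(2) by (simp add: finite_measure.emeasure_finite)
  then have "emeasure \<beta> B = (INF U\<in>{U. B \<subseteq> U \<and> open U}. emeasure \<beta> U)"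
    using outer_regular[of \<beta> B] sets(2) B(1) by (simp add: sets_borel)
  also have "emeasure \<alpha> B \<le> \<dots>"
    using open_le by (intro INF_greatest) auto
  finally show ?thesis .
qed

text \<open>
  Replacing the derivative on \<open>D\<close> by the constant \<open>c\<close> gives another density of \<open>N\<close>, so
  uniqueness of the density applies.
\<close>
lemma RN_deriv_const_on:
  assumes "sigma_finite_measure M" "absolutely_continuous M N" "sets N = sets M" "D \<in> sets M"
    and eq: "\<And>B. B \<in> sets M \<Longrightarrow> B \<subseteq> D \<Longrightarrow> emeasure N B = c * emeasure M B"
  shows "AE x in M. x \<in> D \<longrightarrow> RN_deriv M N x = c"
proof -
  interpret sigma_finite_measure M by fact
  define h where "h x = (if x \<in> D then c else RN_deriv M N x)" for x
  have h: "h \<in> borel_measurable M" using assms(4) unfolding h_def by measurable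
  have "density M h = N"
  proof (rule measure_eqI)
    fix B assume "B \<in> sets (density M h)"
    then have B: "B \<in> sets M" by simp
    have "emeasure (density M h) B = (\<integral>\<^sup>+x. h x * indicator B x \<partial>M)"
      using h B by (rule emeasure_density)
    also have "\<dots> = (\<integral>\<^sup>+x. c * indicator (B \<inter> D) x + RN_deriv M N x * indicator (B - D) x \<partial>M)"
      by (intro nn_integral_cong) (auto simp: h_def indicator_def)
    also have "\<dots> = c * emeasure M (B \<inter> D) + emeasure (density M (RN_deriv M N)) (B - D)"
      using B assms(4)
      by (subst nn_integral_add) (auto simp: emeasure_density nn_integral_cmult_indicator)
    also have "\<dots> = emeasure N (B \<inter> D) + emeasure N (B - D)"
      using density_RN_deriv[OF assms(2,3)] eq[of "B \<inter> D"] B assms(4) by simp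
    also have "\<dots> = emeasure N B"
      using B assms(3,4) by (subst plus_emeasure) (auto intro!: arg_cong[of _ _ "emeasure N"])
    finally show "emeasure (density M h) B = emeasure N B" .
  qed (use assms(3) in simp)
  then have "AE x in M. h x = RN_deriv M N x" using h RN_deriv_unique by blast
  then show ?thesis by eventually_elim (auto simp: h_def)
qed

section \<open>Words\<close>

lemma words_0 [simp]: "words n 0 = {[]}"
  by (auto simp: words_def)

lemma snoc_in_words: "\<sigma> @ [i] \<in> words n (Suc k) \<longleftrightarrow> \<sigma> \<in> words n k \<and> i < n (Suc k)"
proof (cases "length \<sigma> = k")
  case True
  have "(\<forall>j\<in>{1..k}. (\<sigma> @ [i]) ! (j - 1) < n j) \<longleftrightarrow> (\<forall>j\<in>{1..k}. \<sigma> ! (j - 1) < n j)"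
    using True by (intro ball_cong) (auto simp: nth_append)
  moreover have "{1..Suc k} = insert (Suc k) {1..k}" by auto
  ultimately show ?thesis using True by (auto simp: words_def)
qed (auto simp: words_def)

lemma words_Suc: "words n (Suc k) = (\<lambda>(\<sigma>, i). \<sigma> @ [i]) ` (words n k \<times> {..<n (Suc k)})"
proof (intro set_eqI iffI)
  fix w assume w: "w \<in> words n (Suc k)"
  then have "w \<noteq> []" by (auto simp: words_def)
  then have "w = butlast w @ [last w]" by simp
  then show "w \<in> (\<lambda>(\<sigma>, i). \<sigma> @ [i]) ` (words n k \<times> {..<n (Suc k)})"
    using w snoc_in_words[of "butlast w" "last w" n k] by force
qed (auto simp: snoc_in_words)

lemma finite_words: "finite (words n k)"
  by (induction k) (auto simp: words_Suc)

lemma card_words: "card (words n k) = (\<Prod>j=1..k. n j)"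
proof (induction k)
  case (Suc k)
  have "inj_on (\<lambda>(\<sigma>, i). \<sigma> @ [i]) (words n k \<times> {..<n (Suc k)})"
    by (auto simp: inj_on_def)
  then have "card (words n (Suc k)) = card (words n k) * n (Suc k)"
    by (simp add: words_Suc card_image card_cartesian_product)
  with Suc show ?case by simp
qed auto

lemma take_in_words: "w \<in> words n m \<Longrightarrow> k \<le> m \<Longrightarrow> take k w \<in> words n k"
  by (auto simp: words_def)

lemma words_in_all_words: "\<sigma> \<in> words n k \<Longrightarrow> \<sigma> \<in> all_words n"
  by (auto simp: all_words_def)

lemma closed_interval_diameter:
  assumes "closed_interval K"
  shows "K = {Inf K..Inf K + diameter K}"
  using assms unfolding closed_interval_def by auto

section \<open>Geometry of a homogeneous Moran set\<close>

text \<open>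
  The bound \<open>N\<close> on the branching numbers and the rate \<open>\<gamma>\<close> at which the total gaps decay are
  parameters, so that the two Moran sets compared later share all constants derived from them.
\<close>
locale moran =
  fixes n :: "nat \<Rightarrow> nat" and r :: "nat \<Rightarrow> real" and J :: "nat list \<Rightarrow> real set"
    and N :: nat and \<gamma> :: real
  assumes n_ge_2: "\<And>k. k \<ge> 1 \<Longrightarrow> n k \<ge> 2"
    and n_le: "\<And>k. k \<ge> 1 \<Longrightarrow> n k \<le> N"
    and r_pos: "\<And>k. k \<ge> 1 \<Longrightarrow> r k > 0"
    and structure_J: "homogeneous_moran_structure {0..1} n r J"
    and gap_pos: "\<And>k. k \<ge> 1 \<Longrightarrow> total_gap n r k > 0"
    and gap_decay: "\<And>k. k \<ge> 1 \<Longrightarrow> \<gamma> * total_gap n r (Suc k) \<le> total_gap n r k"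
    and \<gamma>_gt_1: "\<gamma> > 1"
begin

abbreviation "gap \<equiv> total_gap n r"
abbreviation "M \<equiv> moran_set n J"

definition len :: "nat \<Rightarrow> real" where "len k = (\<Prod>j=1..k. r j)"
definition pieces :: "nat \<Rightarrow> nat" where "pieces k = (\<Prod>j=1..k. n j)"
definition lo :: "nat list \<Rightarrow> real" where "lo \<sigma> = Inf (J \<sigma>)"
definition hi :: "nat list \<Rightarrow> real" where "hi \<sigma> = lo \<sigma> + len (length \<sigma>)"

lemma len_0 [simp]: "len 0 = 1" by (simp add: len_def)
lemma len_Suc: "len (Suc k) = len k * r (Suc k)" by (simp add: len_def)
lemma pieces_0 [simp]: "pieces 0 = 1" by (simp add: pieces_def)
lemma pieces_Suc: "pieces (Suc k) = pieces k * n (Suc k)" by (simp add: pieces_def)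

lemma len_pos: "0 < len k"
  unfolding len_def by (intro prod_pos) (auto simp: r_pos)

lemma pieces_pos: "0 < pieces k"
  unfolding pieces_def by (intro prod_pos) (use n_ge_2 in force)

lemma card_words_eq_pieces: "card (words n k) = pieces k"
  by (simp add: card_words pieces_def)

text \<open>
  Thus \<open>gap (Suc k)\<close> is the length that the children of a basic interval of rank \<open>k\<close> leave
  uncovered; the index of a gap is one more than the rank of the interval that contains it.
\<close>
lemma gap_Suc: "gap (Suc k) = len k - real (n (Suc k)) * len (Suc k)"
  by (simp add: total_gap_def len_def algebra_simps)

lemma pieces_len_le: "real (pieces k) * len k \<le> 1"
proof (induction k)
  case (Suc k)
  have "real (pieces (Suc k)) * len (Suc k) \<le> real (pieces k) * len k"
    using gap_pos[of "Suc k"] pieces_pos[of k] by (simp add: gap_Suc pieces_Suc mult.assoc)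
  with Suc show ?case by simp
qed auto

lemma two_power_le_pieces: "2 ^ k \<le> pieces k"
proof (induction k)
  case (Suc k)
  then show ?case using mult_le_mono[OF Suc n_ge_2[of "Suc k"]] by (simp add: pieces_Suc mult.commute)
qed auto

lemma inverse_pieces_tendsto_0: "(\<lambda>k. 1 / real (pieces k)) \<longlonglongrightarrow> 0"
proof (rule tendsto_sandwich[of "\<lambda>_. 0" _ _ "\<lambda>k. (1 / 2) ^ k"])
  show "\<forall>\<^sub>F k in sequentially. 1 / real (pieces k) \<le> (1 / 2) ^ k"
  proof (rule always_eventually, rule allI)
    fix k
    have "(2::real) ^ k \<le> real (pieces k)"
      using two_power_le_pieces[of k] by (metis of_nat_le_iff of_nat_numeral of_nat_power)
    then show "1 / real (pieces k) \<le> (1 / 2) ^ k"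
      by (simp add: power_one_over frac_le)
  qed
qed (auto intro!: LIMSEQ_power_zero)

lemma len_tendsto_0: "len \<longlonglongrightarrow> 0"
proof (rule tendsto_sandwich[OF _ _ tendsto_const inverse_pieces_tendsto_0])
  show "\<forall>\<^sub>F k in sequentially. 0 \<le> len k"
    using len_pos by (auto intro!: always_eventually less_imp_le)
  show "\<forall>\<^sub>F k in sequentially. len k \<le> 1 / real (pieces k)"
    using pieces_len_le pieces_pos by (auto intro!: always_eventually simp: field_simps)
qed

lemma gap_Suc_less_len: "gap (Suc k) < len k"
  using len_pos[of "Suc k"] n_ge_2[of "Suc k"] by (simp add: gap_Suc)

lemma moran_structure_J: "moran_structure {0..1} n J"
  using structure_J by (simp add: homogeneous_moran_structure_def)

lemma closed_interval_J: "\<sigma> \<in> words n k \<Longrightarrow> closed_interval (J \<sigma>)"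
  using moran_structure_J words_in_all_words[of \<sigma> n k] by (simp add: moran_structure_def)

lemma diameter_J: "\<sigma> \<in> words n k \<Longrightarrow> diameter (J \<sigma>) = len k"
proof (induction k arbitrary: \<sigma>)
  case 0
  then show ?case using moran_structure_J by (simp add: moran_structure_def)
next
  case (Suc k)
  then obtain \<tau> i where \<tau>: "\<sigma> = \<tau> @ [i]" "\<tau> \<in> words n k" "i < n (Suc k)"
    by (auto simp: words_Suc)
  then have "diameter (J \<sigma>) / diameter (J \<tau>) = r (Suc k)"
    using structure_J unfolding homogeneous_moran_structure_def
    by (metis diff_Suc_1 le_add1 plus_1_eq_Suc)
  then show ?case using Suc.IH[OF \<tau>(2)] len_pos[of k] by (simp add: len_Suc field_simps)
qed

lemma J_eq: "\<sigma> \<in> words n k \<Longrightarrow> J \<sigma> = {lo \<sigma>..hi \<sigma>}"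
  using closed_interval_diameter[OF closed_interval_J, of \<sigma> k] diameter_J[of \<sigma> k]
  by (simp add: lo_def hi_def words_def)

lemma hi_eq: "\<sigma> \<in> words n k \<Longrightarrow> hi \<sigma> = lo \<sigma> + len k"
  by (simp add: hi_def words_def)

lemma interior_J: "\<sigma> \<in> words n k \<Longrightarrow> interior (J \<sigma>) = {lo \<sigma><..<hi \<sigma>}"
  by (simp add: J_eq)

lemma J_child_subset: "\<sigma> \<in> words n k \<Longrightarrow> i < n (Suc k) \<Longrightarrow> J (\<sigma> @ [i]) \<subseteq> J \<sigma>"
  using moran_structure_J unfolding moran_structure_def by (metis diff_Suc_1 le_add1 plus_1_eq_Suc)

lemma children_disjoint:
  "\<sigma> \<in> words n k \<Longrightarrow> i < n (Suc k) \<Longrightarrow> j < n (Suc k) \<Longrightarrow> i \<noteq> j \<Longrightarrow>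
    interior (J (\<sigma> @ [i])) \<inter> interior (J (\<sigma> @ [j])) = {}"
  using moran_structure_J unfolding moran_structure_def by (metis diff_Suc_1 le_add1 plus_1_eq_Suc)

lemma J_append_subset: "\<sigma> @ \<tau> \<in> words n (length \<sigma> + length \<tau>) \<Longrightarrow> J (\<sigma> @ \<tau>) \<subseteq> J \<sigma>"
proof (induction \<tau> rule: rev_induct)
  case (snoc i \<tau>)
  then have "(\<sigma> @ \<tau>) @ [i] \<in> words n (Suc (length \<sigma> + length \<tau>))" by simp
  then have *: "\<sigma> @ \<tau> \<in> words n (length \<sigma> + length \<tau>)" "i < n (Suc (length \<sigma> + length \<tau>))"
    unfolding snoc_in_words by auto
  then show ?case using J_child_subset[OF *] snoc.IH by auto
qed auto

lemma J_subset_take: "w \<in> words n m \<Longrightarrow> k \<le> m \<Longrightarrow> J w \<subseteq> J (take k w)"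
  using J_append_subset[of "take k w" "drop k w"] by (auto simp: words_def)

lemma interiors_disjoint:
  "\<sigma> \<in> words n k \<Longrightarrow> \<tau> \<in> words n k \<Longrightarrow> \<sigma> \<noteq> \<tau> \<Longrightarrow> interior (J \<sigma>) \<inter> interior (J \<tau>) = {}"
proof (induction k arbitrary: \<sigma> \<tau>)
  case (Suc k)
  then obtain \<sigma>' i \<tau>' j where *: "\<sigma> = \<sigma>' @ [i]" "\<sigma>' \<in> words n k" "i < n (Suc k)"
    "\<tau> = \<tau>' @ [j]" "\<tau>' \<in> words n k" "j < n (Suc k)"
    by (auto simp: words_Suc)
  show ?case
  proof (cases "\<sigma>' = \<tau>'")
    case True
    then show ?thesis using children_disjoint[of \<sigma>' k i j] * Suc.prems(3) by auto
  next
    case False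
    then have "interior (J \<sigma>') \<inter> interior (J \<tau>') = {}" using Suc.IH * by blast
    moreover have "interior (J \<sigma>) \<subseteq> interior (J \<sigma>')" "interior (J \<tau>) \<subseteq> interior (J \<tau>')"
      using J_child_subset * by (auto intro!: interior_mono)
    ultimately show ?thesis by blast
  qed
qed auto

lemma lo_separated:
  assumes "\<sigma> \<in> words n k" "\<tau> \<in> words n k" "\<sigma> \<noteq> \<tau>"
  shows "lo \<sigma> + len k \<le> lo \<tau> \<or> lo \<tau> + len k \<le> lo \<sigma>"
proof (rule ccontr)
  assume *: "\<not> ?thesis"
  have "{lo \<sigma><..<hi \<sigma>} \<inter> {lo \<tau><..<hi \<tau>} = {}"
    using interiors_disjoint[OF assms] by (simp add: interior_J[OF assms(1)] interior_J[OF assms(2)])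
  moreover have "(max (lo \<sigma>) (lo \<tau>) + min (hi \<sigma>) (hi \<tau>)) / 2 \<in> {lo \<sigma><..<hi \<sigma>} \<inter> {lo \<tau><..<hi \<tau>}"
    using * len_pos[of k] by (auto simp: hi_eq[OF assms(1)] hi_eq[OF assms(2)] max_def min_def)
  ultimately show False by blast
qed

lemma same_word_if_interior:
  assumes "\<sigma> \<in> words n k" "\<tau> \<in> words n k" "x \<in> J \<sigma>" "x \<in> interior (J \<tau>)"
  shows "\<sigma> = \<tau>"
  using assms lo_separated[OF assms(1,2)] interior_J[OF assms(2)]
    hi_eq[OF assms(1)] hi_eq[OF assms(2)] J_eq[OF assms(1)] by auto

lemma in_some_J: "x \<in> M \<Longrightarrow> \<exists>\<sigma>\<in>words n k. x \<in> J \<sigma>"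
  by (auto simp: moran_set_def)

lemma in_child:
  assumes "x \<in> M" "\<sigma> \<in> words n k" "x \<in> interior (J \<sigma>)"
  shows "\<exists>i<n (Suc k). x \<in> J (\<sigma> @ [i])"
proof -
  obtain w where w: "w \<in> words n (Suc k)" "x \<in> J w" using in_some_J[OF assms(1)] by blast
  then obtain \<tau> i where \<tau>: "w = \<tau> @ [i]" "\<tau> \<in> words n k" "i < n (Suc k)" by (auto simp: words_Suc)
  then have "x \<in> J \<tau>" using J_child_subset w by blast
  then have "\<tau> = \<sigma>" using same_word_if_interior assms \<tau> by blast
  then show ?thesis using \<tau> w by auto
qed

lemma compact_moran_set: "compact M"
proof -
  have *: "compact (\<Union>\<sigma>\<in>words n k. J \<sigma>)" for k
    using finite_words J_eq by (intro compact_UN) auto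
  then have "closed M" unfolding moran_set_def by (intro closed_INT) (auto intro: compact_imp_closed)
  moreover have "bounded M"
    by (rule bounded_subset[OF compact_imp_bounded[OF *[of 0]]]) (unfold moran_set_def, blast)
  ultimately show ?thesis by (simp add: compact_eq_bounded_closed)
qed

text \<open>
  Otherwise the part of \<open>J \<sigma>\<close> within distance \<open>2 * gap (Suc k)\<close> of \<open>p\<close> meets no child. It is longer
  than \<open>gap (Suc k)\<close> even when \<open>p\<close> is an endpoint of \<open>J \<sigma>\<close>, and so leaves too little room for the
  children.
\<close>
lemma child_near:
  assumes "\<sigma> \<in> words n k" "p \<in> J \<sigma>"
  shows "\<exists>i<n (Suc k). \<exists>q\<in>J (\<sigma> @ [i]). \<bar>p - q\<bar> < 2 * gap (Suc k)"
proof (rule ccontr)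
  assume neg: "\<not> ?thesis"
  define u where "u = max (lo \<sigma>) (p - 2 * gap (Suc k))"
  define v where "v = min (hi \<sigma>) (p + 2 * gap (Suc k))"
  have g: "0 < gap (Suc k)" "gap (Suc k) < len k" using gap_pos gap_Suc_less_len by auto
  have p: "lo \<sigma> \<le> p" "p \<le> hi \<sigma>" using assms J_eq by auto
  have uv: "gap (Suc k) < v - u"
    using g p hi_eq[OF assms(1)] by (auto simp: u_def v_def max_def min_def)
  have sub: "lo \<sigma> \<le> u" "v \<le> hi \<sigma>" by (auto simp: u_def v_def)
  have child: "\<sigma> @ [i] \<in> words n (Suc k)" if "i < n (Suc k)" for i
    using assms that by (simp add: snoc_in_words)
  let ?X = "{lo \<sigma>..hi \<sigma>} - {u<..<v}"
  have "(\<Sum>i<n (Suc k). hi (\<sigma> @ [i]) - lo (\<sigma> @ [i])) \<le> measure lborel ?X"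
  proof (rule interval_packing)
    show "lo (\<sigma> @ [i]) \<le> hi (\<sigma> @ [i])" for i by (simp add: hi_def less_imp_le[OF len_pos])
    show "{lo (\<sigma> @ [i])<..<hi (\<sigma> @ [i])} \<subseteq> ?X" if i: "i \<in> {..<n (Suc k)}" for i
    proof
      fix q assume q: "q \<in> {lo (\<sigma> @ [i])<..<hi (\<sigma> @ [i])}"
      then have qJ: "q \<in> J (\<sigma> @ [i])" using J_eq[OF child] i by auto
      then have "q \<in> {lo \<sigma>..hi \<sigma>}" using J_child_subset[OF assms(1)] J_eq[OF assms(1)] i by blast
      moreover have "\<not> \<bar>p - q\<bar> < 2 * gap (Suc k)" using neg qJ i by auto
      then have "q \<notin> {u<..<v}" by (auto simp: u_def v_def)
      ultimately show "q \<in> ?X" by blast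
    qed
    show "disjoint_family_on (\<lambda>i. {lo (\<sigma> @ [i])<..<hi (\<sigma> @ [i])}) {..<n (Suc k)}"
      using children_disjoint[OF assms(1)] interior_J[OF child] by (auto simp: disjoint_family_on_def)
    show "?X \<in> fmeasurable lborel"
      by (rule fmeasurable_Diff) (auto intro!: fmeasurableI simp: emeasure_lborel_Icc_eq)
  qed auto
  also have "measure lborel ?X = measure lborel {lo \<sigma>..hi \<sigma>} - measure lborel {u<..<v}"
    using sub by (intro measurable_measure_Diff) (auto intro!: fmeasurableI simp: emeasure_lborel_Icc_eq)
  also have "\<dots> = len k - (v - u)"
    using uv g hi_eq[OF assms(1)] by simp
  finally have "real (n (Suc k)) * len (Suc k) \<le> len k - (v - u)"
    using hi_eq[OF child] by simp
  then show False using uv by (simp add: gap_Suc)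
qed

text \<open>
  This is \<open>2 * (\<Sum>j. 1 / \<gamma> ^ j)\<close>: the steps of \<open>child_near\<close> taken at all ranks from \<open>k\<close> on add up to
  at most \<open>gap_const\<close> times the first gap.
\<close>
definition gap_const :: real where "gap_const = 2 * \<gamma> / (\<gamma> - 1)"

lemma gap_const_pos: "0 < gap_const"
  using \<gamma>_gt_1 by (simp add: gap_const_def)

text \<open>The summand \<open>2 * gap k\<close> is bounded by a difference so that the sum over the ranks telescopes.\<close>
lemma two_gap_le: "k \<ge> 1 \<Longrightarrow> 2 * gap k \<le> gap_const * (gap k - gap (Suc k))"
proof -
  assume "k \<ge> 1"
  have "2 * gap k * (\<gamma> - 1) \<le> 2 * \<gamma> * (gap k - gap (Suc k))"
    using gap_decay[OF \<open>k \<ge> 1\<close>] by (simp add: algebra_simps)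
  then show ?thesis using \<gamma>_gt_1 by (simp add: gap_const_def field_simps)
qed

lemma descendant_near:
  assumes "\<sigma> \<in> words n k" "p \<in> J \<sigma>"
  shows "\<exists>\<tau>. length \<tau> = j \<and> \<sigma> @ \<tau> \<in> words n (k + j) \<and>
    (\<exists>q\<in>J (\<sigma> @ \<tau>). \<bar>p - q\<bar> \<le> gap_const * (gap (Suc k) - gap (Suc (k + j))))"
proof (induction j)
  case 0
  then show ?case using assms by (intro exI[of _ "[]"]) auto
next
  case (Suc j)
  then obtain \<tau> q where \<tau>: "length \<tau> = j" "\<sigma> @ \<tau> \<in> words n (k + j)" "q \<in> J (\<sigma> @ \<tau>)"
    "\<bar>p - q\<bar> \<le> gap_const * (gap (Suc k) - gap (Suc (k + j)))" by blast
  obtain i q' where i: "i < n (Suc (k + j))" "q' \<in> J ((\<sigma> @ \<tau>) @ [i])"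
    "\<bar>q - q'\<bar> < 2 * gap (Suc (k + j))"
    using child_near[OF \<tau>(2,3)] by blast
  have "\<bar>p - q'\<bar> \<le> gap_const * (gap (Suc k) - gap (Suc (k + Suc j)))"
    using \<tau>(4) i(3) two_gap_le[of "Suc (k + j)"] by (simp add: algebra_simps)
  then show ?case using \<tau> i
    by (intro exI[of _ "\<tau> @ [i]"]) (auto simp: snoc_in_words simp flip: append_assoc)
qed

text \<open>All these basic intervals lie in the given interval enlarged by their length on both sides.\<close>
lemma cylinder_count_interval:
  assumes "0 \<le> D" and S: "S \<subseteq> words n k" and hit: "\<And>\<sigma>. \<sigma> \<in> S \<Longrightarrow> J \<sigma> \<inter> {a..a + D * len k} \<noteq> {}"
  shows "real (card S) \<le> D + 2"
proof -
  let ?X = "{a - len k..a + D * len k + len k}"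
  have "(\<Sum>\<sigma>\<in>S. hi \<sigma> - lo \<sigma>) \<le> measure lborel ?X"
  proof (rule interval_packing)
    show "finite S" using finite_subset[OF S finite_words] .
    show "lo \<sigma> \<le> hi \<sigma>" for \<sigma> using len_pos by (simp add: hi_def less_imp_le)
    show "{lo \<sigma><..<hi \<sigma>} \<subseteq> ?X" if "\<sigma> \<in> S" for \<sigma>
      using hit[OF that] J_eq[of \<sigma> k] hi_eq[of \<sigma> k] S that by auto
    show "disjoint_family_on (\<lambda>\<sigma>. {lo \<sigma><..<hi \<sigma>}) S"
      using interiors_disjoint S interior_J unfolding disjoint_family_on_def by (metis subsetD)
  qed (auto intro!: fmeasurableI simp: emeasure_lborel_Icc_eq)
  also have "measure lborel ?X = (D + 2) * len k"
    using assms(1) len_pos[of k] by (simp add: algebra_simps)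
  also have "(\<Sum>\<sigma>\<in>S. hi \<sigma> - lo \<sigma>) = (\<Sum>\<sigma>\<in>S. len k)"
    using hi_eq S by (intro sum.cong) auto
  finally show ?thesis using len_pos[of k] by simp
qed

end

section \<open>The uniform Bernoulli measure\<close>

locale moran_bernoulli = moran +
  fixes \<mu> :: "real measure"
  assumes bernoulli: "uniform_bernoulli n J \<mu>"
begin

sublocale prob_space \<mu>
  using bernoulli by (simp add: uniform_bernoulli_def)

lemma sets_\<mu> [simp, measurable_cong]: "sets \<mu> = sets borel"
  using bernoulli by (simp add: uniform_bernoulli_def)

lemma space_\<mu> [simp]: "space \<mu> = UNIV"
  using sets_eq_imp_space_eq[OF sets_\<mu>] by simp

lemma prob_M: "prob M = 1"
  using bernoulli by (simp add: uniform_bernoulli_def)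

lemma prob_cylinder: "\<sigma> \<in> words n k \<Longrightarrow> prob (cylinder n J \<sigma>) = 1 / real (pieces k)"
  using bernoulli by (simp add: uniform_bernoulli_def pieces_def)

lemma borel_M: "M \<in> sets borel"
  using compact_moran_set by (simp add: borel_compact)

lemma borel_cylinder: "\<sigma> \<in> words n k \<Longrightarrow> cylinder n J \<sigma> \<in> sets borel"
  using borel_M by (simp add: cylinder_def J_eq)

lemma cylinder_nonempty: "\<sigma> \<in> words n k \<Longrightarrow> cylinder n J \<sigma> \<noteq> {}"
  using prob_cylinder[of \<sigma> k] pieces_pos[of k] by auto

lemma M_eq_Union_cylinders: "M = (\<Union>\<sigma>\<in>words n k. cylinder n J \<sigma>)"
  using in_some_J by (auto simp: cylinder_def)

lemma Union_cylinders_borel: "T \<subseteq> words n k \<Longrightarrow> (\<Union>\<sigma>\<in>T. cylinder n J \<sigma>) \<in> sets borel"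
  using borel_cylinder finite_subset[OF _ finite_words] by (intro sets.finite_UN) auto

text \<open>
  Cylinders may share endpoints, but the overlaps are null: subadditivity bounds the measure of a union
  of cylinders and that of the union of the remaining ones from above, and both bounds together only
  just reach the total mass \<open>1\<close>.
\<close>
lemma prob_Union_cylinders:
  assumes "S \<subseteq> words n k"
  shows "prob (\<Union>\<sigma>\<in>S. cylinder n J \<sigma>) = real (card S) / real (pieces k)"
proof -
  have le: "prob (\<Union>\<sigma>\<in>T. cylinder n J \<sigma>) \<le> real (card T) / real (pieces k)"
    if T: "T \<subseteq> words n k" for T
  proof -
    have "prob (\<Union>\<sigma>\<in>T. cylinder n J \<sigma>) \<le> (\<Sum>\<sigma>\<in>T. prob (cylinder n J \<sigma>))"
      using finite_subset[OF T finite_words] borel_cylinder T by (intro measure_UNION_le) auto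
    also have "\<dots> = (\<Sum>\<sigma>\<in>T. 1 / real (pieces k))"
      using prob_cylinder T by (intro sum.cong) auto
    finally show ?thesis by simp
  qed
  let ?T = "words n k - S"
  have "M = (\<Union>\<sigma>\<in>S. cylinder n J \<sigma>) \<union> (\<Union>\<sigma>\<in>?T. cylinder n J \<sigma>)"
    using M_eq_Union_cylinders[of k] assms by auto
  then have "1 \<le> prob (\<Union>\<sigma>\<in>S. cylinder n J \<sigma>) + prob (\<Union>\<sigma>\<in>?T. cylinder n J \<sigma>)"
    using prob_M Union_cylinders_borel[OF assms] Union_cylinders_borel[of ?T]
      measure_Un_le[of "\<Union>\<sigma>\<in>S. cylinder n J \<sigma>" \<mu> "\<Union>\<sigma>\<in>?T. cylinder n J \<sigma>"]
    by auto
  also have "\<dots> \<le> prob (\<Union>\<sigma>\<in>S. cylinder n J \<sigma>) + real (card ?T) / real (pieces k)"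
    using le[of ?T] by auto
  also have "real (card ?T) / real (pieces k) = 1 - real (card S) / real (pieces k)"
    using card_Diff_subset[OF finite_subset[OF assms finite_words] assms]
      card_mono[OF finite_words assms] pieces_pos[of k]
    by (simp add: card_words_eq_pieces diff_divide_distrib)
  finally show ?thesis using le[OF assms] by linarith
qed

lemma prob_point: "x \<in> M \<Longrightarrow> prob {x} = 0"
proof -
  assume x: "x \<in> M"
  have "prob {x} \<le> 1 / real (pieces k)" for k
  proof -
    obtain \<sigma> where \<sigma>: "\<sigma> \<in> words n k" "x \<in> J \<sigma>" using in_some_J[OF x] by blast
    then have "prob {x} \<le> prob (cylinder n J \<sigma>)"
      using x borel_cylinder by (intro finite_measure_mono) (auto simp: cylinder_def)
    then show ?thesis using prob_cylinder[OF \<sigma>(1)] by simp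
  qed
  then have "prob {x} \<le> 0"
    by (intro LIMSEQ_le_const[OF inverse_pieces_tendsto_0]) auto
  then show ?thesis by (simp add: measure_le_0_iff)
qed

text \<open>The endpoints of a basic interval carry no mass, whereas its cylinder does.\<close>
lemma interior_point:
  assumes "\<sigma> \<in> words n k"
  shows "\<exists>x\<in>M. x \<in> interior (J \<sigma>)"
proof (rule ccontr)
  assume neg: "\<not> ?thesis"
  have "cylinder n J \<sigma> \<subseteq> ({lo \<sigma>} \<inter> M) \<union> ({hi \<sigma>} \<inter> M)"
  proof
    fix x assume "x \<in> cylinder n J \<sigma>"
    then show "x \<in> ({lo \<sigma>} \<inter> M) \<union> ({hi \<sigma>} \<inter> M)"
      using neg J_eq[OF assms] by (force simp: cylinder_def)
  qed
  then have "prob (cylinder n J \<sigma>) \<le> prob (({lo \<sigma>} \<inter> M) \<union> ({hi \<sigma>} \<inter> M))"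
    using borel_M by (intro finite_measure_mono) auto
  also have "\<dots> \<le> prob ({lo \<sigma>} \<inter> M) + prob ({hi \<sigma>} \<inter> M)"
    using borel_M by (intro measure_Un_le) auto
  also have "\<dots> = 0"
    using prob_point[of "lo \<sigma>"] prob_point[of "hi \<sigma>"]
    by (cases "lo \<sigma> \<in> M"; cases "hi \<sigma> \<in> M") auto
  finally show False using prob_cylinder[OF assms] pieces_pos[of k] by simp
qed

text \<open>
  Following \<open>descendant_near\<close> to a rank where the basic intervals are short leads near \<open>p\<close> to a
  cylinder, and cylinders are nonempty. The factor \<open>2\<close> absorbs the length of the last basic interval.
\<close>
lemma moran_point_near:
  assumes "\<sigma> \<in> words n k" "p \<in> J \<sigma>"
  shows "\<exists>x\<in>M. \<bar>p - x\<bar> < 2 * gap_const * gap (Suc k)"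
proof -
  have pos: "0 < gap_const * gap (Suc k)" using gap_const_pos gap_pos by simp
  then have "\<forall>\<^sub>F m in sequentially. len m < gap_const * gap (Suc k)"
    using order_tendstoD(2)[OF len_tendsto_0] by blast
  then obtain m where "\<And>m'. m' \<ge> m \<Longrightarrow> len m' < gap_const * gap (Suc k)"
    by (auto simp: eventually_sequentially)
  then have small: "len (k + m) < gap_const * gap (Suc k)" by simp
  obtain \<tau> q where \<tau>: "\<sigma> @ \<tau> \<in> words n (k + m)" "q \<in> J (\<sigma> @ \<tau>)"
    "\<bar>p - q\<bar> \<le> gap_const * (gap (Suc k) - gap (Suc (k + m)))"
    using descendant_near[OF assms] by blast
  obtain x where x: "x \<in> M" "x \<in> J (\<sigma> @ \<tau>)"
    using cylinder_nonempty[OF \<tau>(1)] by (auto simp: cylinder_def)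
  have "\<bar>q - x\<bar> \<le> len (k + m)"
    using \<tau>(2) x(2) J_eq[OF \<tau>(1)] hi_eq[OF \<tau>(1)] by auto
  moreover have "0 \<le> gap_const * gap (Suc (k + m))"
    using gap_const_pos gap_pos[of "Suc (k + m)"] by simp
  ultimately have "\<bar>p - x\<bar> < 2 * gap_const * gap (Suc k)"
    using \<tau>(3) small by (simp add: algebra_simps)
  with x show ?thesis by blast
qed

text \<open>The midpoint of a longer gap would have a point of the Moran set nearby, inside the gap.\<close>
lemma gaps_small:
  assumes "\<sigma> \<in> words n k" "lo \<sigma> \<le> u" "v \<le> hi \<sigma>" "{u<..<v} \<inter> M = {}"
  shows "v - u \<le> 4 * gap_const * gap (Suc k)"
proof (rule ccontr)
  assume neg: "\<not> ?thesis"
  moreover have "0 < gap_const * gap (Suc k)" using gap_const_pos gap_pos by simp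
  ultimately have "(u + v) / 2 \<in> J \<sigma>" using assms J_eq[OF assms(1)] by (auto simp: field_simps)
  then obtain x where "x \<in> M" "\<bar>(u + v) / 2 - x\<bar> < 2 * gap_const * gap (Suc k)"
    using moran_point_near[OF assms(1)] by blast
  then have "x \<in> {u<..<v} \<inter> M" using neg unfolding abs_less_iff by (simp add: field_simps)
  with assms show False by blast
qed

lemma cylinder_in_cluster:
  assumes "\<sigma> \<in> words n k" "4 * gap_const * gap (Suc k) \<le> \<delta>"
    and "x \<in> cylinder n J \<sigma>" "y \<in> cylinder n J \<sigma>"
  shows "y \<in> cluster M \<delta> x"
proof -
  have xy: "x \<in> M" "y \<in> M" "lo \<sigma> \<le> x" "x \<le> hi \<sigma>" "lo \<sigma> \<le> y" "y \<le> hi \<sigma>"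
    using assms J_eq by (auto simp: cylinder_def)
  have "x \<le> u \<longleftrightarrow> y \<le> u" if uv: "u + \<delta> < v" "{u<..<v} \<inter> M = {}" for u v
  proof -
    have "x \<le> u \<or> v \<le> x" "y \<le> u \<or> v \<le> y" using uv(2) xy by force+
    moreover have "\<not> (lo \<sigma> \<le> u \<and> v \<le> hi \<sigma>)"
      using gaps_small[OF assms(1) _ _ uv(2)] uv(1) assms(2) by linarith
    moreover have "u < v \<or> \<delta> < 0" using uv(1) by linarith
    moreover have "0 < \<delta>"
      using assms(2) gap_const_pos gap_pos[of "Suc k"]
      by (smt (verit, ccfv_SIG) le_add1 mult_pos_pos plus_1_eq_Suc)
    ultimately show ?thesis using xy by linarith
  qed
  then show ?thesis using xy by (auto simp: cluster_def)
qed

text \<open>Both clusters and bi-Lipschitz images of clusters are parts of this kind.\<close>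
definition isolated_part :: "real \<Rightarrow> real set \<Rightarrow> bool" where
  "isolated_part \<delta> A \<longleftrightarrow> A \<subseteq> M \<and> (\<forall>a\<in>A. \<forall>z\<in>M - A. \<delta> \<le> \<bar>a - z\<bar>)"

definition inner_words :: "nat \<Rightarrow> real set \<Rightarrow> nat list set" where
  "inner_words m A = {\<sigma> \<in> words n m. cylinder n J \<sigma> \<subseteq> A}"

text \<open>
  An isolated part contains every cylinder of rank \<open>m\<close> that it meets, because the gaps within such a
  cylinder are too short to separate points of the part from points outside. The constant \<open>8\<close> is twice
  that of \<open>gaps_small\<close>, since \<open>cluster_subset_isolated\<close> compares \<open>\<delta>\<close>-clusters with \<open>2 * \<delta>\<close>-isolated
  sets.
\<close>
lemma isolated_part_eq_Union:
  assumes "isolated_part \<delta> A" "8 * gap_const * gap (Suc m) \<le> \<delta>"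
  shows "A = (\<Union>\<sigma>\<in>inner_words m A. cylinder n J \<sigma>)"
proof
  show "A \<subseteq> (\<Union>\<sigma>\<in>inner_words m A. cylinder n J \<sigma>)"
  proof
    fix x assume x: "x \<in> A"
    then have xM: "x \<in> M" using assms by (auto simp: isolated_part_def)
    then obtain \<sigma> where \<sigma>: "\<sigma> \<in> words n m" "x \<in> cylinder n J \<sigma>"
      using M_eq_Union_cylinders by blast
    have "0 < gap_const * gap (Suc m)" using gap_const_pos gap_pos by simp
    then have "cluster M (\<delta> / 2) x \<subseteq> A"
      using assms x by (intro cluster_subset_isolated) (auto simp: isolated_part_def)
    moreover have "cylinder n J \<sigma> \<subseteq> cluster M (\<delta> / 2) x"
      using cylinder_in_cluster[OF \<sigma>(1) _ \<sigma>(2)] assms(2) by auto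
    ultimately show "x \<in> (\<Union>\<sigma>\<in>inner_words m A. cylinder n J \<sigma>)"
      using \<sigma> by (auto simp: inner_words_def)
  qed
qed (auto simp: inner_words_def)

lemma isolated_part_borel:
  assumes "isolated_part \<delta> A" "8 * gap_const * gap (Suc m) \<le> \<delta>"
  shows "A \<in> sets borel"
proof -
  have "inner_words m A \<subseteq> words n m" by (auto simp: inner_words_def)
  then show ?thesis
    by (subst isolated_part_eq_Union[OF assms]) (rule Union_cylinders_borel)
qed

lemma prob_isolated_part:
  assumes "isolated_part \<delta> A" "8 * gap_const * gap (Suc m) \<le> \<delta>"
  shows "prob A = real (card (inner_words m A)) / real (pieces m)"
  using prob_Union_cylinders[of "inner_words m A" m] isolated_part_eq_Union[OF assms]
  by (simp add: inner_words_def)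

text \<open>The number \<open>l\<close> of further ranks is the same for all \<open>k\<close>; this uniformity is what bounds the
  number of cylinders in a cluster.\<close>
lemma fine_level:
  assumes "0 < \<theta>"
  shows "\<exists>l. \<forall>k. gap (Suc (k + l)) \<le> \<theta> * gap (Suc k)"
proof -
  have decay: "\<gamma> ^ l * gap (Suc (k + l)) \<le> gap (Suc k)" for k l
  proof (induction l)
    case (Suc l)
    have "\<gamma> ^ l * (\<gamma> * gap (Suc (Suc (k + l)))) \<le> \<gamma> ^ l * gap (Suc (k + l))"
      using gap_decay[of "Suc (k + l)"] \<gamma>_gt_1 by (intro mult_left_mono) auto
    with Suc show ?case by (simp add: mult_ac)
  qed auto
  obtain l where l: "1 / \<theta> < \<gamma> ^ l" using real_arch_pow[OF \<gamma>_gt_1] by blast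
  have "gap (Suc (k + l)) \<le> \<theta> * gap (Suc k)" for k
  proof -
    have "1 / \<theta> * gap (Suc (k + l)) \<le> \<gamma> ^ l * gap (Suc (k + l))"
      using l gap_pos[of "Suc (k + l)"] by (intro mult_right_mono) auto
    also have "\<dots> \<le> gap (Suc k)" by (rule decay)
    finally show ?thesis using assms by (simp add: field_simps)
  qed
  then show ?thesis by blast
qed

section \<open>Clusters at the scale of the gaps\<close>

text \<open>
  In \<open>long_gap_exists\<close> every child, enlarged by \<open>2 * scale k\<close> on both sides, gains the length
  \<open>4 * scale k\<close>. The constant \<open>8\<close> keeps the total gain of at most \<open>N\<close> children at or below half
  of the gap.
\<close>
definition scale :: "nat \<Rightarrow> real" where "scale k = gap (Suc k) / (8 * real N)"

abbreviation part :: "nat \<Rightarrow> real \<Rightarrow> real set" where "part k \<equiv> cluster M (scale k)"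

lemma N_ge_2: "2 \<le> N" using n_le[of 1] n_ge_2[of 1] by simp

lemma scale_pos: "0 < scale k" using gap_pos N_ge_2 by (simp add: scale_def)

lemma scale_less_gap: "2 * scale k < gap (Suc k)"
proof -
  have "2 * gap (Suc k) < gap (Suc k) * (8 * real N)"
    using gap_pos[of "Suc k"] N_ge_2 by (simp add: mult.commute[of 2])
  then show ?thesis using N_ge_2 by (simp add: scale_def field_simps)
qed

lemma scale_Suc_le: "scale (Suc k) \<le> scale k"
proof -
  have "1 * gap (Suc (Suc k)) \<le> \<gamma> * gap (Suc (Suc k))"
    using \<gamma>_gt_1 gap_pos[of "Suc (Suc k)"] by (intro mult_right_mono) auto
  also have "\<dots> \<le> gap (Suc k)" using gap_decay by simp
  finally show ?thesis using N_ge_2 by (simp add: scale_def divide_right_mono)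
qed

text \<open>
  If all gaps in \<open>J \<sigma>\<close> were short, the children enlarged by \<open>2 * scale k\<close> on both sides would cover
  the interior of \<open>J \<sigma>\<close>, although their total length is too small for that.
\<close>
lemma long_gap_exists:
  assumes "\<sigma> \<in> words n k"
  shows "\<exists>u v. lo \<sigma> \<le> u \<and> v \<le> hi \<sigma> \<and> u + scale k < v \<and> {u<..<v} \<inter> M = {}"
proof (rule ccontr)
  assume neg: "\<not> ?thesis"
  let ?s = "2 * scale k"
  let ?c = "\<lambda>i. lo (\<sigma> @ [i]) - ?s" and ?d = "\<lambda>i. hi (\<sigma> @ [i]) + ?s"
  have child: "\<sigma> @ [i] \<in> words n (Suc k)" if "i < n (Suc k)" for i
    using assms that by (simp add: snoc_in_words)
  have "hi \<sigma> - lo \<sigma> \<le> (\<Sum>i<n (Suc k). ?d i - ?c i)"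
  proof (rule interval_covering)
    show "?c i \<le> ?d i" for i using scale_pos[of k] len_pos by (simp add: hi_def add_increasing2 less_imp_le)
    show "lo \<sigma> \<le> hi \<sigma>" using len_pos by (simp add: hi_def less_imp_le)
    show "{lo \<sigma><..<hi \<sigma>} \<subseteq> (\<Union>i<n (Suc k). {?c i..?d i})"
    proof
      fix p assume p: "p \<in> {lo \<sigma><..<hi \<sigma>}"
      \<comment> \<open>The window of radius \<open>?s = 2 * scale k\<close> remains longer than \<open>scale k\<close> when an endpoint of \<open>J \<sigma>\<close> cuts it off.\<close>
      define u where "u = max (lo \<sigma>) (p - ?s)"
      define v where "v = min (hi \<sigma>) (p + ?s)"
      have "u + scale k < v"
        using p scale_less_gap[of k] gap_Suc_less_len[of k] scale_pos[of k] hi_eq[OF assms]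
        by (auto simp: u_def v_def max_def min_def)
      moreover have uv: "lo \<sigma> \<le> u" "v \<le> hi \<sigma>" by (auto simp: u_def v_def)
      ultimately obtain z where z: "z \<in> {u<..<v}" "z \<in> M" using neg by blast
      then have "z \<in> interior (J \<sigma>)" using uv interior_J[OF assms] by auto
      then obtain i where i: "i < n (Suc k)" "z \<in> J (\<sigma> @ [i])" using in_child[OF z(2) assms] by blast
      then have "p \<in> {?c i..?d i}" using z(1) J_eq[OF child] by (auto simp: u_def v_def)
      with i show "p \<in> (\<Union>i<n (Suc k). {?c i..?d i})" by blast
    qed
  qed auto
  also have "\<dots> = real (n (Suc k)) * (len (Suc k) + 4 * scale k)"
    using hi_eq[OF child] by simp
  also have "\<dots> = real (n (Suc k)) * len (Suc k) + real (n (Suc k)) * (4 * scale k)"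
    by (simp add: algebra_simps)
  also have "real (n (Suc k)) * (4 * scale k) \<le> real N * (4 * scale k)"
    using n_le[of "Suc k"] scale_pos[of k] by (intro mult_right_mono) auto
  also have "\<dots> = gap (Suc k) / 2" using N_ge_2 by (simp add: scale_def)
  finally have "len k \<le> (len k - gap (Suc k)) + gap (Suc k) / 2"
    using hi_eq[OF assms] by (simp add: gap_Suc)
  then show False using gap_pos[of "Suc k"] by simp
qed

text \<open>
  Let two points of a cluster be farther apart. The stretch between them that keeps the distance
  \<open>len k\<close> from both is longer than \<open>scale k\<close>, so it contains a point of the Moran set. The basic
  interval of rank \<open>k\<close> around that point lies between the two points, and so does its long gap.
\<close>
lemma part_diameter_aux:
  assumes "y \<in> part k x" "x < y"
  shows "y - x \<le> 3 * len k"
proof (rule ccontr)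
  assume neg: "\<not> ?thesis"
  have "scale k < len k" using scale_less_gap[of k] gap_Suc_less_len[of k] scale_pos[of k] by simp
  then have long: "(x + len k) + scale k < y - len k" using neg by simp
  moreover have "\<not> (x \<le> x + len k \<longleftrightarrow> y \<le> x + len k)"
    using neg len_pos[of k] by simp
  ultimately obtain z where z: "z \<in> M" "x + len k < z" "z < y - len k"
    using assms(1) unfolding cluster_def by fastforce
  obtain \<sigma> where \<sigma>: "\<sigma> \<in> words n k" "z \<in> J \<sigma>" using in_some_J[OF z(1)] by blast
  obtain u v where uv: "lo \<sigma> \<le> u" "v \<le> hi \<sigma>" "u + scale k < v" "{u<..<v} \<inter> M = {}"
    using long_gap_exists[OF \<sigma>(1)] by blast
  have "x \<le> u" "\<not> y \<le> u"
    using uv z \<sigma> J_eq[OF \<sigma>(1)] hi_eq[OF \<sigma>(1)] scale_pos[of k] by auto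
  with assms(1) uv(3,4) show False unfolding cluster_def by blast
qed

lemma part_diameter:
  assumes "y \<in> part k x" "x \<in> M"
  shows "\<bar>y - x\<bar> \<le> 3 * len k"
proof -
  have "x \<in> part k y" using cluster_eq[OF assms(1)] self_in_cluster[OF assms(2)] by simp
  then show ?thesis
    using part_diameter_aux[OF assms(1)] part_diameter_aux[of x k y] len_pos[of k]
    by (cases x y rule: linorder_cases) auto
qed

lemma part_shrinks:
  assumes "x \<in> M" "open U" "x \<in> U"
  shows "\<exists>k0. \<forall>k\<ge>k0. part k x \<subseteq> U"
proof -
  obtain e where e: "0 < e" "ball x e \<subseteq> U" using assms openE by blast
  then have "\<forall>\<^sub>F k in sequentially. len k < e / 3"
    using order_tendstoD(2)[OF len_tendsto_0, of "e / 3"] by simp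
  then obtain k0 where "\<And>k. k \<ge> k0 \<Longrightarrow> len k < e / 3" by (auto simp: eventually_sequentially)
  then have "part k x \<subseteq> ball x e" if "k \<ge> k0" for k
    using part_diameter[OF _ assms(1), of _ k] that
    by (fastforce simp: dist_real_def abs_minus_commute)
  with e show ?thesis by blast
qed

lemma part_nested: "part (Suc k) x \<subseteq> part k x"
  by (rule cluster_mono[OF scale_Suc_le])

lemma part_nested_le: "k \<le> m \<Longrightarrow> part m x \<subseteq> part k x"
  by (induction m rule: dec_induct) (use part_nested in blast)+

lemma part_isolated: "isolated_part (scale k) (part k x)"
  using cluster_isolated[of _ M "scale k" x] cluster_subset
  by (fastforce simp: isolated_part_def intro: less_imp_le)

text \<open>
  A cluster meets at most two cylinders of rank \<open>k\<close>, the leftmost and the rightmost one: the basic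
  interval of any other would lie between them and contain a long gap that splits the cluster.
\<close>
lemma prob_part_le: "prob (part k x) \<le> 2 / real (pieces k)"
proof -
  define S where "S = {\<sigma> \<in> words n k. cylinder n J \<sigma> \<inter> part k x \<noteq> {}}"
  have "finite S" using finite_words[of n k] by (simp add: S_def)
  have sub: "part k x \<subseteq> (\<Union>\<sigma>\<in>S. cylinder n J \<sigma>)"
  proof
    fix y assume y: "y \<in> part k x"
    then have "y \<in> M" using cluster_subset by blast
    then obtain \<sigma> where "\<sigma> \<in> words n k" "y \<in> cylinder n J \<sigma>"
      using M_eq_Union_cylinders by blast
    with y show "y \<in> (\<Union>\<sigma>\<in>S. cylinder n J \<sigma>)" by (auto simp: S_def)
  qed
  have "card S \<le> 2"
  proof (cases "S = {}")
    case False
    obtain \<sigma> where \<sigma>: "\<sigma> \<in> S" "\<And>\<tau>. \<tau> \<in> S \<Longrightarrow> lo \<sigma> \<le> lo \<tau>"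
      using arg_min_if_finite[OF \<open>finite S\<close> False, of lo] by (meson not_less)
    obtain \<rho> where \<rho>: "\<rho> \<in> S" "\<And>\<tau>. \<tau> \<in> S \<Longrightarrow> lo \<tau> \<le> lo \<rho>"
      using arg_min_if_finite[OF \<open>finite S\<close> False, of "\<lambda>\<tau>. - lo \<tau>"] by (meson neg_less_iff_less not_less)
    have "\<tau> \<in> {\<sigma>, \<rho>}" if \<tau>: "\<tau> \<in> S" for \<tau>
    proof (rule ccontr)
      assume neg: "\<tau> \<notin> {\<sigma>, \<rho>}"
      have w: "\<sigma> \<in> words n k" "\<tau> \<in> words n k" "\<rho> \<in> words n k"
        using \<sigma> \<tau> \<rho> by (auto simp: S_def)
      obtain y z where y: "y \<in> J \<sigma>" "y \<in> part k x" and z: "z \<in> J \<rho>" "z \<in> part k x"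
        using \<sigma>(1) \<rho>(1) by (auto simp: S_def cylinder_def)
      have "lo \<sigma> + len k \<le> lo \<tau>" "lo \<tau> + len k \<le> lo \<rho>"
        using lo_separated[OF w(1,2)] lo_separated[OF w(2,3)] \<sigma>(2)[OF \<tau>] \<rho>(2)[OF \<tau>] neg len_pos[of k]
        by auto
      then have "y \<le> lo \<tau>" "hi \<tau> \<le> z"
        using y z J_eq[OF w(1)] J_eq[OF w(3)] hi_eq[OF w(1)] hi_eq[OF w(2)] by auto
      moreover obtain u v where uv: "lo \<tau> \<le> u" "v \<le> hi \<tau>" "u + scale k < v" "{u<..<v} \<inter> M = {}"
        using long_gap_exists[OF w(2)] by blast
      ultimately have "y \<le> u" "\<not> z \<le> u" using scale_pos[of k] by auto
      moreover have "z \<in> part k y" using cluster_eq[OF y(2)] z(2) by simp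
      ultimately show False using uv(3,4) unfolding cluster_def by blast
    qed
    then have "S \<subseteq> {\<sigma>, \<rho>}" by blast
    then have "card S \<le> card {\<sigma>, \<rho>}" by (intro card_mono) auto
    also have "\<dots> \<le> 2" by (simp add: card_insert_if)
    finally show ?thesis .
  qed auto
  have "prob (part k x) \<le> prob (\<Union>\<sigma>\<in>S. cylinder n J \<sigma>)"
    using sub \<open>finite S\<close> borel_cylinder by (intro finite_measure_mono) (auto simp: S_def)
  also have "\<dots> = real (card S) / real (pieces k)"
    by (rule prob_Union_cylinders) (auto simp: S_def)
  also have "\<dots> \<le> 2 / real (pieces k)"
    using \<open>card S \<le> 2\<close> by (simp add: divide_right_mono)
  finally show ?thesis .
qed

lemma pieces_add_le: "pieces (k + l) \<le> pieces k * N ^ l"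
proof (induction l)
  case (Suc l)
  have "pieces (k + l) * n (Suc (k + l)) \<le> (pieces k * N ^ l) * N"
    using Suc n_le by (intro mult_le_mono) auto
  then show ?case by (simp add: pieces_Suc mult_ac)
qed auto

text \<open>
  Comparing the number of cylinders with the mass bound of \<open>prob_part_le\<close> gives a bound in which
  \<open>k\<close> does not occur.
\<close>
lemma cylinder_count_part:
  assumes "x \<in> M" "8 * gap_const * gap (Suc (k + l)) \<le> scale k"
  shows "0 < card (inner_words (k + l) (part k x))" "card (inner_words (k + l) (part k x)) \<le> 2 * N ^ l"
proof -
  let ?S = "inner_words (k + l) (part k x)"
  have "x \<in> (\<Union>\<sigma>\<in>?S. cylinder n J \<sigma>)"
    using self_in_cluster[OF assms(1)] isolated_part_eq_Union[OF part_isolated assms(2)] by blast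
  moreover have "finite ?S" using finite_words by (simp add: inner_words_def)
  ultimately show "0 < card ?S" by (auto simp: card_gt_0_iff)
  have "real (card ?S) / real (pieces (k + l)) \<le> 2 / real (pieces k)"
    using prob_part_le[of k x] prob_isolated_part[OF part_isolated assms(2)] by simp
  then have "real (card ?S) * real (pieces k) \<le> 2 * real (pieces (k + l))"
    using pieces_pos by (simp add: field_simps)
  then have "real (card ?S * pieces k) \<le> real (2 * pieces (k + l))" by simp
  then have "card ?S * pieces k \<le> 2 * pieces (k + l)" by (simp only: of_nat_le_iff)
  also have "\<dots> \<le> 2 * N ^ l * pieces k" using pieces_add_le[of k l] by (simp add: mult_ac)
  finally show "card ?S \<le> 2 * N ^ l" using pieces_pos[of k] by simp
qed

lemma part_level: "\<exists>l. 8 * gap_const * gap (Suc (k + l)) \<le> scale k"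
proof -
  have "0 < scale k / (8 * gap_const * gap (Suc k))"
    using scale_pos gap_const_pos gap_pos[of "Suc k"] by simp
  then obtain l where "gap (Suc (k + l)) \<le> scale k / (8 * gap_const * gap (Suc k)) * gap (Suc k)"
    using fine_level by blast
  then have "8 * gap_const * gap (Suc (k + l)) \<le> scale k"
    using gap_const_pos gap_pos[of "Suc k"] by (simp add: field_simps)
  then show ?thesis by blast
qed

lemma part_borel: "part k x \<in> sets borel"
  using isolated_part_borel[OF part_isolated] part_level by blast

lemma finite_parts: "finite (part k ` M)"
proof -
  obtain l where l: "8 * gap_const * gap (Suc (k + l)) \<le> scale k" using part_level by blast
  have "part k ` M \<subseteq> (\<lambda>S. \<Union>\<sigma>\<in>S. cylinder n J \<sigma>) ` Pow (words n (k + l))"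
  proof
    fix A assume "A \<in> part k ` M"
    then have "A = (\<Union>\<sigma>\<in>inner_words (k + l) A. cylinder n J \<sigma>)"
      using isolated_part_eq_Union[OF part_isolated l] by blast
    moreover have "inner_words (k + l) A \<in> Pow (words n (k + l))" by (auto simp: inner_words_def)
    ultimately show "A \<in> (\<lambda>S. \<Union>\<sigma>\<in>S. cylinder n J \<sigma>) ` Pow (words n (k + l))" by blast
  qed
  then show ?thesis using finite_words by (meson finite_Pow_iff finite_imageI finite_subset)
qed

text \<open>
  The set \<open>A\<close> may be the whole Moran set or a single cluster of rank \<open>m\<close>; the clusters of rank at
  least \<open>m\<close> then serve as the refining partitions of \<open>A\<close>.
\<close>
lemma emeasure_le_of_parts:
  assumes sets: "sets \<alpha> = sets borel" "sets \<beta> = sets borel"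
    and fin: "finite_measure \<alpha>" "finite_measure \<beta>"
    and A: "A \<in> sets borel" "A \<subseteq> M" "\<And>k x. x \<in> A \<Longrightarrow> k \<ge> m \<Longrightarrow> part k x \<subseteq> A"
    and le: "\<And>k x. x \<in> A \<Longrightarrow> k \<ge> m \<Longrightarrow> emeasure \<alpha> (part k x) \<le> emeasure \<beta> (part k x)"
    and B: "B \<in> sets borel" "B \<subseteq> A"
  shows "emeasure \<alpha> B \<le> emeasure \<beta> B"
proof (rule emeasure_le_of_partitions[where Q = "\<lambda>k. part (m + k)", OF sets fin A(1) _ _ _ _ _ _ _ _ B])
  fix k x assume x: "x \<in> A"
  show "x \<in> part (m + k) x" using x A(2) self_in_cluster by blast
  show "y \<in> part (m + k) x \<Longrightarrow> part (m + k) y = part (m + k) x" for y by (rule cluster_eq)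
  show "part (m + Suc k) x \<subseteq> part (m + k) x" using part_nested by simp
  show "part (m + k) x \<subseteq> A" using A(3) x by simp
  show "part (m + k) x \<in> sets borel" by (rule part_borel)
  show "emeasure \<alpha> (part (m + k) x) \<le> emeasure \<beta> (part (m + k) x)" using le x by simp
next
  show "finite (part (m + k) ` A)" for k
    using finite_parts by (rule finite_subset[rotated]) (use A(2) in blast)
next
  fix x U assume "x \<in> A" "open U" "x \<in> U"
  then obtain k1 where "\<forall>k\<ge>k1. part k x \<subseteq> U" using part_shrinks A(2) by blast
  then have "part (m + k1) x \<subseteq> U" by simp
  then show "\<exists>k. part (m + k) x \<subseteq> U" by blast
qed

end

section \<open>A bi-Lipschitz map between two Moran sets\<close>

locale moran_pair =
  E: moran_bernoulli n r I N \<gamma> \<mu> + F: moran_bernoulli n r J N \<gamma> \<nu>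
  for n r I J N \<gamma> \<mu> \<nu> +
  fixes f :: "real \<Rightarrow> real" and C :: real
  assumes onto: "f ` moran_set n I = moran_set n J" and C_pos: "0 < C"
    and lower: "\<And>x y. x \<in> moran_set n I \<Longrightarrow> y \<in> moran_set n I \<Longrightarrow> \<bar>x - y\<bar> \<le> C * \<bar>f x - f y\<bar>"
    and upper: "\<And>x y. x \<in> moran_set n I \<Longrightarrow> y \<in> moran_set n I \<Longrightarrow> \<bar>f x - f y\<bar> \<le> C * \<bar>x - y\<bar>"
begin

abbreviation "X \<equiv> moran_set n I"
abbreviation "Y \<equiv> moran_set n J"

lemma inj_f: "inj_on f X"
  using lower by (fastforce intro!: inj_onI)

text \<open>The value \<open>0\<close> outside \<open>Y\<close> is arbitrary, since \<open>Y\<close> has full measure.\<close>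
definition inv_f :: "real \<Rightarrow> real" where "inv_f y = (if y \<in> Y then inv_into X f y else 0)"

lemma inv_f_image: "x \<in> X \<Longrightarrow> inv_f (f x) = x"
  using inj_f onto by (auto simp: inv_f_def)

lemma inv_f_measurable [measurable]: "inv_f \<in> borel_measurable borel"
  unfolding inv_f_def
proof (rule borel_measurable_continuous_on_if)
  have "C-lipschitz_on Y (inv_into X f)"
  proof (rule lipschitz_onI)
    fix y z assume "y \<in> Y" "z \<in> Y"
    then show "dist (inv_into X f y) (inv_into X f z) \<le> C * dist y z"
      using lower[of "inv_into X f y" "inv_into X f z"] onto
      by (auto simp: dist_real_def f_inv_into_f inv_into_into)
  qed (use C_pos in simp)
  then show "continuous_on Y (inv_into X f)" by (rule lipschitz_on_continuous_on)
qed (auto simp: F.borel_M)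

text \<open>
  Transporting \<open>\<nu>\<close> by the inverse map gives a probability measure on all of \<open>borel\<close> that agrees with
  \<open>B \<mapsto> \<nu> (f ` B)\<close> on the Borel subsets of \<open>X\<close>.
\<close>
definition \<rho> :: "real measure" where "\<rho> = distr \<nu> borel inv_f"

sublocale \<rho>: prob_space \<rho>
  unfolding \<rho>_def by (intro F.prob_space_distr) simp

lemma sets_\<rho> [simp, measurable_cong]: "sets \<rho> = sets borel" by (simp add: \<rho>_def)

lemma image_eq: "B \<subseteq> X \<Longrightarrow> f ` B = inv_f -` B \<inter> Y"
  using inv_f_image onto by (auto simp: image_iff) (metis imageE)

lemma emeasure_\<rho>:
  assumes B: "B \<in> sets borel" "B \<subseteq> X"
  shows "emeasure \<rho> B = emeasure \<nu> (f ` B)"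
proof -
  have meas: "inv_f -` B \<in> sets borel" using measurable_sets[OF inv_f_measurable B(1)] by simp
  have "AE y in \<nu>. y \<in> Y" using F.prob_M F.borel_M by (intro F.AE_prob_1) simp
  then have "emeasure \<nu> (inv_f -` B) = emeasure \<nu> (inv_f -` B \<inter> Y)"
    using meas F.borel_M by (intro emeasure_eq_AE) auto
  then show ?thesis using B by (simp add: \<rho>_def emeasure_distr image_eq)
qed

lemma measure_\<rho>: "B \<in> sets borel \<Longrightarrow> B \<subseteq> X \<Longrightarrow> measure \<rho> B = measure \<nu> (f ` B)"
  using emeasure_\<rho>[of B] by (simp add: measure_def)

text \<open>
  The image of a cylinder lies in an interval of length \<open>2 * C\<close> times that of a basic interval
  of the same rank, and such an interval meets at most \<open>2 * C + 2\<close> of these.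
\<close>
lemma \<rho>_cylinder_le:
  assumes \<sigma>: "\<sigma> \<in> words n k"
  shows "measure \<rho> (cylinder n I \<sigma>) \<le> (2 * C + 2) * measure \<mu> (cylinder n I \<sigma>)"
proof -
  let ?D = "cylinder n I \<sigma>"
  obtain x where x: "x \<in> ?D" using E.cylinder_nonempty[OF \<sigma>] by blast
  have sub: "?D \<subseteq> X" by (auto simp: cylinder_def)
  define S where "S = {\<tau> \<in> words n k. cylinder n J \<tau> \<inter> f ` ?D \<noteq> {}}"
  have "real (card S) \<le> 2 * C + 2"
  proof (rule F.cylinder_count_interval[where a = "f x - C * E.len k" and k = k])
    fix \<tau> assume "\<tau> \<in> S"
    then obtain y where y: "y \<in> ?D" "f y \<in> J \<tau>" by (auto simp: S_def cylinder_def)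
    have "\<bar>x - y\<bar> \<le> E.len k"
      using x y(1) E.J_eq[OF \<sigma>] E.hi_eq[OF \<sigma>] by (auto simp: cylinder_def)
    then have "C * \<bar>x - y\<bar> \<le> C * E.len k" using C_pos by simp
    then have "\<bar>f x - f y\<bar> \<le> C * E.len k" using upper[of x y] x y sub by force
    then have "f y \<in> {f x - C * E.len k..f x - C * E.len k + 2 * C * E.len k}"
      by (auto simp: abs_le_iff)
    with y show "J \<tau> \<inter> {f x - C * E.len k..f x - C * E.len k + 2 * C * E.len k} \<noteq> {}" by blast
  qed (use C_pos in \<open>auto simp: S_def\<close>)
  have "measure \<rho> ?D = measure \<nu> (f ` ?D)"
    using E.borel_cylinder[OF \<sigma>] sub by (rule measure_\<rho>)
  also have "\<dots> \<le> measure \<nu> (\<Union>\<tau>\<in>S. cylinder n J \<tau>)"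
  proof (rule F.finite_measure_mono)
    show "f ` ?D \<subseteq> (\<Union>\<tau>\<in>S. cylinder n J \<tau>)"
    proof
      fix y assume y: "y \<in> f ` ?D"
      then have "y \<in> Y" using onto sub by blast
      then obtain \<tau> where "\<tau> \<in> words n k" "y \<in> cylinder n J \<tau>"
        using F.M_eq_Union_cylinders by blast
      with y show "y \<in> (\<Union>\<tau>\<in>S. cylinder n J \<tau>)" by (auto simp: S_def)
    qed
    show "(\<Union>\<tau>\<in>S. cylinder n J \<tau>) \<in> sets \<nu>"
      using F.Union_cylinders_borel[of S k] by (auto simp: S_def)
  qed
  also have "\<dots> = real (card S) / real (E.pieces k)"
    by (rule F.prob_Union_cylinders) (auto simp: S_def)
  also have "\<dots> \<le> (2 * C + 2) / real (E.pieces k)"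
    using \<open>real (card S) \<le> 2 * C + 2\<close> by (simp add: divide_right_mono)
  finally show ?thesis using E.prob_cylinder[OF \<sigma>] by simp
qed

lemma \<rho>_part_le: "measure \<rho> (E.part k x) \<le> (2 * C + 2) * measure \<mu> (E.part k x)"
proof -
  let ?A = "E.part k x"
  obtain l where l: "8 * E.gap_const * E.gap (Suc (k + l)) \<le> E.scale k" using E.part_level by blast
  let ?S = "E.inner_words (k + l) ?A"
  have S: "finite ?S" "?S \<subseteq> words n (k + l)" using finite_words by (auto simp: E.inner_words_def)
  have "measure \<rho> ?A = measure \<rho> (\<Union>\<sigma>\<in>?S. cylinder n I \<sigma>)"
    using E.isolated_part_eq_Union[OF E.part_isolated l, of x] by simp
  also have "\<dots> \<le> (\<Sum>\<sigma>\<in>?S. measure \<rho> (cylinder n I \<sigma>))"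
    using S E.borel_cylinder by (intro measure_UNION_le) auto
  also have "\<dots> \<le> (\<Sum>\<sigma>\<in>?S. (2 * C + 2) * measure \<mu> (cylinder n I \<sigma>))"
    using S \<rho>_cylinder_le by (intro sum_mono) auto
  also have "\<dots> = (\<Sum>\<sigma>\<in>?S. (2 * C + 2) * (1 / real (E.pieces (k + l))))"
    using S E.prob_cylinder by (intro sum.cong) auto
  also have "\<dots> = (2 * C + 2) * measure \<mu> ?A"
    by (simp add: E.prob_isolated_part[OF E.part_isolated l])
  finally show ?thesis .
qed

lemma emeasure_scale_\<mu>:
  "0 \<le> c \<Longrightarrow> emeasure (scale_measure (ennreal c) \<mu>) B = ennreal (c * measure \<mu> B)"
  by (simp add: E.emeasure_eq_measure ennreal_mult')

lemma finite_measure_scale: "finite_measure M \<Longrightarrow> finite_measure (scale_measure (ennreal c) M)"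
  by (auto intro!: finite_measureI simp: space_scale_measure finite_measure.emeasure_finite ennreal_mult_eq_top_iff)

lemma \<rho>_le:
  assumes "B \<in> sets borel" "B \<subseteq> X"
  shows "emeasure \<rho> B \<le> ennreal (2 * C + 2) * emeasure \<mu> B"
proof -
  have "emeasure \<rho> B \<le> emeasure (scale_measure (ennreal (2 * C + 2)) \<mu>) B"
  proof (rule E.emeasure_le_of_parts[where A = X and m = 0])
    show "finite_measure \<rho>" by unfold_locales
    show "finite_measure (scale_measure (ennreal (2 * C + 2)) \<mu>)"
      by (rule finite_measure_scale) unfold_locales
    show "emeasure \<rho> (E.part k x) \<le> emeasure (scale_measure (ennreal (2 * C + 2)) \<mu>) (E.part k x)"
      for k x
      using \<rho>_part_le[of k x] C_pos
      by (subst emeasure_scale_\<mu>) (auto simp: \<rho>.emeasure_eq_measure intro: ennreal_leI)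
  qed (use assms E.borel_M cluster_subset in auto)
  then show ?thesis by simp
qed

text \<open>In particular \<open>B \<mapsto> \<nu> (f ` B)\<close> is a measure, so \<open>measure_of\<close> does not degenerate to zero.\<close>
lemma pullback_eq_restrict: "pullback_measure X f \<nu> = restrict_space \<rho> X"
proof -
  have sets: "sets (restrict_space borel X) = (\<inter>) X ` sets \<rho>"
    by (simp add: sets_restrict_space)
  have "sigma_sets X (sets (restrict_space borel X)) = sets (restrict_space borel X)"
    using sets.sigma_sets_eq[of "restrict_space borel X"] by (simp add: space_restrict_space)
  then have "pullback_measure X f \<nu> = measure_of X (sets (restrict_space borel X)) (emeasure \<rho>)"
    unfolding pullback_measure_def
    using E.borel_M by (intro measure_of_eq) (auto simp: sets_restrict_space emeasure_\<rho>)
  also have "\<dots> = restrict_space \<rho> X"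
    using sets_eq_imp_space_eq[OF sets_\<rho>] by (simp add: restrict_space_def[of \<rho>] sets)
  finally show ?thesis .
qed

lemma pullback_absolutely_continuous:
  "absolutely_continuous (restrict_space \<mu> X) (pullback_measure X f \<nu>)"
  unfolding absolutely_continuous_def pullback_eq_restrict
proof
  fix B assume "B \<in> null_sets (restrict_space \<mu> X)"
  then have B: "B \<subseteq> X" "B \<in> sets borel" "emeasure \<mu> B = 0"
    using E.borel_M by (auto simp: null_sets_restrict_space)
  then have "emeasure \<rho> B = 0" using \<rho>_le[of B] by simp
  then show "B \<in> null_sets (restrict_space \<rho> X)"
    using B E.borel_M by (auto simp: null_sets_restrict_space)
qed

lemma common_level:
  "\<exists>l. \<forall>k. 8 * E.gap_const * E.gap (Suc (k + l)) \<le> E.scale k \<and>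
           8 * E.gap_const * E.gap (Suc (k + l)) \<le> E.scale k / C"
proof -
  \<comment> \<open>The maximum makes one level serve both thresholds, \<open>E.scale k\<close> and \<open>E.scale k / C\<close>.
    In \<open>64 = 8 * 8\<close> one factor is the \<open>8\<close> in front of \<open>gap_const\<close>, the other the one in \<open>scale\<close>.\<close>
  define D where "D = max 1 C"
  define \<theta> where "\<theta> = 1 / (64 * E.gap_const * real N * D)"
  have D: "1 \<le> D" "C \<le> D" by (auto simp: D_def)
  then have "0 < \<theta>" using E.gap_const_pos E.N_ge_2 by (simp add: \<theta>_def)
  then obtain l where l: "\<And>k. E.gap (Suc (k + l)) \<le> \<theta> * E.gap (Suc k)"
    using E.fine_level by blast
  have "8 * E.gap_const * E.gap (Suc (k + l)) \<le> E.scale k / D" for k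
  proof -
    have "8 * E.gap_const * E.gap (Suc (k + l)) \<le> 8 * E.gap_const * (\<theta> * E.gap (Suc k))"
      using l E.gap_const_pos by (intro mult_left_mono) auto
    also have "\<dots> = E.scale k / D"
      using E.gap_const_pos E.N_ge_2 D by (simp add: \<theta>_def E.scale_def field_simps)
    finally show ?thesis .
  qed
  moreover have "E.scale k / D \<le> E.scale k" "E.scale k / D \<le> E.scale k / C" for k
    using D C_pos E.scale_pos[of k] by (auto simp: field_simps intro!: divide_left_mono)
  ultimately show ?thesis by (meson order_trans)
qed

lemma image_isolated:
  assumes "E.isolated_part \<delta> A"
  shows "F.isolated_part (\<delta> / C) (f ` A)"
  unfolding F.isolated_part_def
proof (intro conjI ballI)
  show "f ` A \<subseteq> Y" using assms onto by (auto simp: E.isolated_part_def)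
  fix a z assume "a \<in> f ` A" "z \<in> Y - f ` A"
  then obtain x y where xy: "x \<in> A" "a = f x" "y \<in> X - A" "z = f y" using onto by blast
  then have "\<delta> \<le> \<bar>x - y\<bar>" "x \<in> X" using assms by (auto simp: E.isolated_part_def)
  then have "\<delta> \<le> C * \<bar>a - z\<bar>" using lower[of x y] xy by auto
  then show "\<delta> / C \<le> \<bar>a - z\<bar>" using C_pos by (simp add: field_simps)
qed

text \<open>
  With one level \<open>l\<close> serving both the cluster and its image, the ratio is a quotient of two cylinder
  counts of the same rank. The denominator is bounded, so \<open>fact K\<close> is a common denominator of
  all the ratios.
\<close>
lemma part_ratio_discrete:
  "\<exists>K. \<forall>k. \<forall>x\<in>X. 0 < measure \<mu> (E.part k x) \<and>
     (\<exists>q::nat. measure \<rho> (E.part k x) / measure \<mu> (E.part k x) = real q / real (fact K))"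
proof -
  obtain l where l: "\<And>k. 8 * E.gap_const * E.gap (Suc (k + l)) \<le> E.scale k"
    "\<And>k. 8 * E.gap_const * E.gap (Suc (k + l)) \<le> E.scale k / C"
    using common_level by blast
  let ?K = "2 * N ^ l"
  have "0 < measure \<mu> (E.part k x) \<and>
     (\<exists>q::nat. measure \<rho> (E.part k x) / measure \<mu> (E.part k x) = real q / real (fact ?K))"
    if x: "x \<in> X" for k x
  proof -
    let ?A = "E.part k x"
    define a where "a = card (E.inner_words (k + l) ?A)"
    define b where "b = card (F.inner_words (k + l) (f ` ?A))"
    have a: "0 < a" "a \<le> ?K" using E.cylinder_count_part[OF x l(1)] by (auto simp: a_def)
    have \<mu>: "measure \<mu> ?A = real a / real (E.pieces (k + l))"
      unfolding a_def by (rule E.prob_isolated_part[OF E.part_isolated l(1)])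
    have "measure \<rho> ?A = measure \<nu> (f ` ?A)"
      by (intro measure_\<rho> E.part_borel cluster_subset)
    also have "\<dots> = real b / real (E.pieces (k + l))"
      unfolding b_def by (rule F.prob_isolated_part[OF image_isolated[OF E.part_isolated] l(2)])
    finally have ratio: "measure \<rho> ?A / measure \<mu> ?A = real b / real a"
      using \<mu> E.pieces_pos[of "k + l"] by simp
    have "a dvd fact ?K" using a by (intro dvd_fact) auto
    then obtain d where d: "fact ?K = a * d" by blast
    then have "0 < d" using fact_nonzero[of ?K, where 'a = nat] by (cases d) auto
    then have "real b / real a = real (b * d) / real (fact ?K)"
      using a d by simp
    then show ?thesis using ratio a \<mu> E.pieces_pos[of "k + l"] by (metis divide_pos_pos of_nat_0_less_iff)
  qed
  then show ?thesis by blast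
qed

text \<open>
  Among the clusters inside \<open>U\<close> of rank at least \<open>k0\<close> one has minimal ratio \<open>c\<close>. All its
  subclusters have ratio at least \<open>c\<close>, hence so do all its Borel subsets \<open>B\<close>. As the whole cluster has
  ratio exactly \<open>c\<close>, the inequalities for \<open>B\<close> and for its complement in the cluster are equalities.
\<close>
lemma proportional_part:
  assumes U: "open U" "x \<in> X" "x \<in> U"
  shows "\<exists>k\<ge>k0. \<exists>y\<in>X. \<exists>c\<ge>0. E.part k y \<subseteq> U \<and>
    (\<forall>B\<in>sets borel. B \<subseteq> E.part k y \<longrightarrow> measure \<rho> B = c * measure \<mu> B)"
proof -
  obtain K where K: "\<And>k x. x \<in> X \<Longrightarrow> 0 < measure \<mu> (E.part k x)"
    "\<And>k x. x \<in> X \<Longrightarrow> \<exists>q::nat. measure \<rho> (E.part k x) / measure \<mu> (E.part k x) = real q / real (fact K)"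
    using part_ratio_discrete by blast
  define ok where "ok q \<longleftrightarrow> (\<exists>k\<ge>k0. \<exists>y\<in>X. E.part k y \<subseteq> U \<and>
    measure \<rho> (E.part k y) / measure \<mu> (E.part k y) = real q / real (fact K))" for q :: nat
  obtain k1 where "\<And>k. k \<ge> k1 \<Longrightarrow> E.part k x \<subseteq> U" using E.part_shrinks[OF U(2,1,3)] by blast
  then have "E.part (max k0 k1) x \<subseteq> U" by simp
  then have "\<exists>q. ok q" using K(2)[OF U(2), of "max k0 k1"] U(2) unfolding ok_def
    by (metis max.cobounded1)
  define q where "q = (LEAST q. ok q)"
  have "ok q" unfolding q_def using \<open>\<exists>q. ok q\<close> by (rule LeastI_ex)
  then obtain k y where ky: "k \<ge> k0" "y \<in> X" "E.part k y \<subseteq> U"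
    "measure \<rho> (E.part k y) / measure \<mu> (E.part k y) = real q / real (fact K)"
    by (auto simp: ok_def)
  let ?A = "E.part k y"
  define c where "c = real q / real (fact K)"
  have total: "measure \<rho> ?A = c * measure \<mu> ?A"
    using ky(4) K(1)[OF ky(2), of k] by (simp add: c_def field_simps)
  have inside: "E.part m z \<subseteq> ?A" if "z \<in> ?A" "m \<ge> k" for m z
    using E.part_nested_le[OF that(2), of z] cluster_eq[OF that(1)] by simp
  have part_ge: "c * measure \<mu> (E.part m z) \<le> measure \<rho> (E.part m z)" if z: "z \<in> ?A" "m \<ge> k" for m z
  proof -
    have zX: "z \<in> X" using z cluster_subset by blast
    obtain q' :: nat where q':
      "measure \<rho> (E.part m z) / measure \<mu> (E.part m z) = real q' / real (fact K)"
      using K(2)[OF zX] by blast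
    then have "ok q'" using inside[OF z] ky z zX by (auto simp: ok_def intro!: exI[of _ m])
    then have "q \<le> q'" unfolding q_def by (rule Least_le)
    then have "c \<le> measure \<rho> (E.part m z) / measure \<mu> (E.part m z)"
      unfolding q' c_def by (intro divide_right_mono) auto
    then show ?thesis using K(1)[OF zX, of m] by (simp add: field_simps)
  qed
  have "0 \<le> c" by (simp add: c_def)
  have ge: "c * measure \<mu> B \<le> measure \<rho> B" if B: "B \<in> sets borel" "B \<subseteq> ?A" for B
  proof -
    have "emeasure (scale_measure (ennreal c) \<mu>) B \<le> emeasure \<rho> B"
    proof (rule E.emeasure_le_of_parts[where A = ?A and m = k])
      show "finite_measure \<rho>" by unfold_locales
      show "finite_measure (scale_measure (ennreal c) \<mu>)" by (rule finite_measure_scale) unfold_locales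
      show "emeasure (scale_measure (ennreal c) \<mu>) (E.part m z) \<le> emeasure \<rho> (E.part m z)"
        if "z \<in> ?A" "m \<ge> k" for m z
        using part_ge[OF that] \<open>0 \<le> c\<close>
        by (simp add: emeasure_scale_\<mu> \<rho>.emeasure_eq_measure ennreal_leI
            del: emeasure_scale_measure)
    qed (use B inside E.part_borel cluster_subset in auto)
    then show ?thesis using \<open>0 \<le> c\<close>
      by (simp add: emeasure_scale_\<mu> \<rho>.emeasure_eq_measure del: emeasure_scale_measure)
  qed
  have "measure \<rho> B = c * measure \<mu> B" if B: "B \<in> sets borel" "B \<subseteq> ?A" for B
  proof -
    have diff: "?A - B \<in> sets borel" using B E.part_borel by auto
    have "measure \<rho> (?A - B) = measure \<rho> ?A - measure \<rho> B"
      using B E.part_borel by (intro \<rho>.finite_measure_Diff) auto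
    moreover have "measure \<mu> (?A - B) = measure \<mu> ?A - measure \<mu> B"
      using B E.part_borel by (intro E.finite_measure_Diff) auto
    then have "c * measure \<mu> ?A = c * measure \<mu> B + c * measure \<mu> (?A - B)"
      unfolding distrib_left[symmetric] by simp
    ultimately show ?thesis using ge[OF B] ge[OF diff] total by auto
  qed
  then show ?thesis using ky \<open>0 \<le> c\<close> by blast
qed

text \<open>
  The cluster is taken inside the interior of \<open>I \<sigma>\<close> and of rank at least that of \<open>\<sigma>\<close>. It contains
  a cylinder, and since a point of that cylinder is interior to \<open>I \<sigma>\<close>, no other word
  of the rank of \<open>\<sigma>\<close> can be a prefix of its word.
\<close>
lemma proportional_subcylinder:
  assumes "\<sigma> \<in> all_words n"
  shows "\<exists>\<tau>. \<sigma> @ \<tau> \<in> all_words n \<and> (\<exists>c\<ge>0. \<forall>B\<in>sets borel.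
    B \<subseteq> cylinder n I (\<sigma> @ \<tau>) \<longrightarrow> measure \<rho> B = c * measure \<mu> B)"
proof -
  obtain s where \<sigma>: "\<sigma> \<in> words n s" using assms by (auto simp: all_words_def)
  obtain x where x: "x \<in> X" "x \<in> interior (I \<sigma>)" using E.interior_point[OF \<sigma>] by blast
  obtain k y c where k: "k \<ge> s" "y \<in> X" "c \<ge> 0" "E.part k y \<subseteq> interior (I \<sigma>)"
    and proportional: "\<And>B. B \<in> sets borel \<Longrightarrow> B \<subseteq> E.part k y \<Longrightarrow> measure \<rho> B = c * measure \<mu> B"
    using proportional_part[OF open_interior x, of s] by blast
  obtain l where l: "8 * E.gap_const * E.gap (Suc (k + l)) \<le> E.scale k" using E.part_level by blast
  have "y \<in> (\<Union>w\<in>E.inner_words (k + l) (E.part k y). cylinder n I w)"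
    using self_in_cluster[OF k(2)] E.isolated_part_eq_Union[OF E.part_isolated l] by blast
  then obtain w where w: "w \<in> words n (k + l)" "cylinder n I w \<subseteq> E.part k y" "y \<in> I w"
    by (auto simp: E.inner_words_def cylinder_def)
  have "y \<in> interior (I \<sigma>)" using k(4) self_in_cluster[OF k(2)] by blast
  moreover have "y \<in> I (take s w)" using E.J_subset_take[OF w(1), of s] w(3) k(1) by auto
  ultimately have "take s w = \<sigma>"
    using E.same_word_if_interior take_in_words[OF w(1), of s] \<sigma> k(1) by simp
  then have "w = \<sigma> @ drop s w" by (metis append_take_drop_id)
  then show ?thesis using w proportional k(3) words_in_all_words[OF w(1)]
    by (intro exI[of _ "drop s w"]) (metis subset_trans)
qed

end

section \<open>Constancy of the derivative on a subcylinder\<close>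

theorem theorem1p1:
  fixes n :: "nat \<Rightarrow> nat" and r :: "nat \<Rightarrow> real"
    and I J :: "nat list \<Rightarrow> real set" and E F :: "real set"
    and \<mu> \<nu> :: "real measure" and f :: "real \<Rightarrow> real"
  assumes n_ge_2: "\<And>k. k \<ge> 1 \<Longrightarrow> n k \<ge> 2"
    and r_pos: "\<And>k. k \<ge> 1 \<Longrightarrow> r k > 0"
    and structure_E: "homogeneous_moran_structure {0..1} n r I" and E: "E = moran_set n I"
    and structure_F: "homogeneous_moran_structure {0..1} n r J" and F: "F = moran_set n J"
    and mu: "uniform_bernoulli n I \<mu>"
    and nu: "uniform_bernoulli n J \<nu>"
    and f: "bi_lipschitz_onto E F f"
    and n_bounded: "bdd_above (n ` {1..})"
    and gap_pos: "\<And>k. k \<ge> 1 \<Longrightarrow> total_gap n r k > 0"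
    and gap_ratio: "(INF k\<in>{1..}. total_gap n r k / total_gap n r (k + 1)) > 1"
    and wsc_E: "weak_separation n I"
    and wsc_F: "weak_separation n J"
  shows "absolutely_continuous (restrict_space \<mu> E) (pullback_measure E f \<nu>) \<and>
    (\<forall>\<sigma>\<in>all_words n. \<exists>\<tau>. \<sigma> @ \<tau> \<in> all_words n \<and>
       (\<exists>c\<ge>0. AE x in restrict_space \<mu> E. x \<in> cylinder n I (\<sigma> @ \<tau>) \<longrightarrow>
          RN_deriv (restrict_space \<mu> E) (pullback_measure E f \<nu>) x = ennreal c) \<and>
       (\<forall>B\<in>sets borel. B \<subseteq> cylinder n I (\<sigma> @ \<tau>) \<and> measure \<mu> B > 0 \<longrightarrow>
          measure \<nu> (f ` B) / measure \<mu> B =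
          measure \<nu> (f ` cylinder n I (\<sigma> @ \<tau>)) / measure \<mu> (cylinder n I (\<sigma> @ \<tau>))))"
proof -
  define \<gamma> where "\<gamma> = (INF k\<in>{1..}. total_gap n r k / total_gap n r (k + 1))"
  obtain N where N: "\<And>k. k \<ge> 1 \<Longrightarrow> n k \<le> N" using n_bounded by (auto simp: bdd_above_def)
  have gap_decay: "\<gamma> * total_gap n r (Suc k) \<le> total_gap n r k" if "k \<ge> 1" for k
  proof -
    have "0 \<le> total_gap n r m / total_gap n r (m + 1)" if "m \<ge> 1" for m
      using gap_pos[of m] gap_pos[of "m + 1"] that by (auto intro!: divide_nonneg_nonneg less_imp_le)
    then have "\<gamma> \<le> total_gap n r k / total_gap n r (k + 1)"
      unfolding \<gamma>_def using that by (intro cINF_lower bdd_belowI[of _ 0]) auto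
    then show ?thesis using gap_pos[of "k + 1"] by (simp add: field_simps)
  qed
  obtain C where onto: "f ` E = F" and C: "C > 0"
    and lip: "\<And>x y. x \<in> E \<Longrightarrow> y \<in> E \<Longrightarrow> inverse C * \<bar>x - y\<bar> \<le> \<bar>f x - f y\<bar> \<and> \<bar>f x - f y\<bar> \<le> C * \<bar>x - y\<bar>"
    using f unfolding bi_lipschitz_onto_def by blast
  interpret moran_pair n r I J N \<gamma> \<mu> \<nu> f C
  proof unfold_locales
    fix x y assume "x \<in> moran_set n I" "y \<in> moran_set n I"
    then have "inverse C * \<bar>x - y\<bar> \<le> \<bar>f x - f y\<bar> \<and> \<bar>f x - f y\<bar> \<le> C * \<bar>x - y\<bar>"
      using lip E by blast
    then show "\<bar>x - y\<bar> \<le> C * \<bar>f x - f y\<bar>" "\<bar>f x - f y\<bar> \<le> C * \<bar>x - y\<bar>"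
      using C by (auto simp: field_simps)
  qed (use n_ge_2 N r_pos structure_E structure_F mu nu gap_pos gap_decay gap_ratio onto C E F
      in \<open>auto simp: \<gamma>_def\<close>)
  have ac: "absolutely_continuous (restrict_space \<mu> E) (pullback_measure E f \<nu>)"
    using pullback_absolutely_continuous E by simp
  moreover have "\<exists>\<tau>. \<sigma> @ \<tau> \<in> all_words n \<and>
       (\<exists>c\<ge>0. AE x in restrict_space \<mu> E. x \<in> cylinder n I (\<sigma> @ \<tau>) \<longrightarrow>
          RN_deriv (restrict_space \<mu> E) (pullback_measure E f \<nu>) x = ennreal c) \<and>
       (\<forall>B\<in>sets borel. B \<subseteq> cylinder n I (\<sigma> @ \<tau>) \<and> measure \<mu> B > 0 \<longrightarrow>
          measure \<nu> (f ` B) / measure \<mu> B =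
          measure \<nu> (f ` cylinder n I (\<sigma> @ \<tau>)) / measure \<mu> (cylinder n I (\<sigma> @ \<tau>)))"
    if \<sigma>: "\<sigma> \<in> all_words n" for \<sigma>
  proof -
    obtain \<tau> c where \<tau>: "\<sigma> @ \<tau> \<in> all_words n" "c \<ge> 0"
      and proportional: "\<And>B. B \<in> sets borel \<Longrightarrow> B \<subseteq> cylinder n I (\<sigma> @ \<tau>) \<Longrightarrow> measure \<rho> B = c * measure \<mu> B"
      using proportional_subcylinder[OF \<sigma>] by blast
    let ?D = "cylinder n I (\<sigma> @ \<tau>)"
    obtain m where m: "\<sigma> @ \<tau> \<in> words n m" using \<tau>(1) by (auto simp: all_words_def)
    have D: "?D \<in> sets borel" "?D \<subseteq> X" "0 < measure \<mu> ?D"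
      using E.borel_cylinder[OF m] E.prob_cylinder[OF m] E.pieces_pos[of m] by (auto simp: cylinder_def)
    have "AE x in restrict_space \<mu> X. x \<in> ?D \<longrightarrow>
        RN_deriv (restrict_space \<mu> X) (pullback_measure X f \<nu>) x = ennreal c"
    proof (rule RN_deriv_const_on)
      show "sigma_finite_measure (restrict_space \<mu> X)"
        by (rule sigma_finite_measure_restrict_space) (use E.borel_M in \<open>auto intro: E.sigma_finite_measure_axioms\<close>)
      show "absolutely_continuous (restrict_space \<mu> X) (pullback_measure X f \<nu>)"
        by (rule pullback_absolutely_continuous)
      show "sets (pullback_measure X f \<nu>) = sets (restrict_space \<mu> X)"
        unfolding pullback_eq_restrict by (intro sets_restrict_space_cong) simp
      show "?D \<in> sets (restrict_space \<mu> X)"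
        using D E.borel_M by (simp add: sets_restrict_space_iff)
      fix B assume "B \<in> sets (restrict_space \<mu> X)" "B \<subseteq> ?D"
      then have B: "B \<in> sets borel" "B \<subseteq> X" "B \<subseteq> ?D"
        using E.borel_M by (auto simp: sets_restrict_space_iff)
      then show "emeasure (pullback_measure X f \<nu>) B = ennreal c * emeasure (restrict_space \<mu> X) B"
        unfolding pullback_eq_restrict using E.borel_M proportional[of B] \<tau>(2)
        by (simp add: emeasure_restrict_space E.emeasure_eq_measure \<rho>.emeasure_eq_measure ennreal_mult')
    qed
    moreover have "measure \<nu> (f ` B) / measure \<mu> B = measure \<nu> (f ` ?D) / measure \<mu> ?D"
      if B: "B \<in> sets borel" "B \<subseteq> ?D" "measure \<mu> B > 0" for B
    proof -
      have "measure \<nu> (f ` B) = c * measure \<mu> B" "measure \<nu> (f ` ?D) = c * measure \<mu> ?D"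
        using proportional[OF B(1,2)] proportional[OF D(1)] measure_\<rho>[of B] measure_\<rho>[of ?D] B D by auto
      then show ?thesis using B D by simp
    qed
    ultimately show ?thesis using \<tau> E by blast
  qed
  ultimately show ?thesis by blast
qed

end
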